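(* For each $u\in\mathbb{Z}_{>0}$, $$\mathcal{N}(u)\le O\!\left(\tau(u)^2\,2^{\omega(u)}\right)\le O\!\left(\left(\frac{\sqrt2\,\log u}{\omega(u)}\right)^{2\omega(u)}\right).$$ Moreover, $\mathcal{N}(u)<O\!\left((\log u)^{\log 8}\right)$ for all $u\in\mathcal{D}$ outside of a subset of asymptotic density $0$. However, there exist infinite sequences $\{u_k\}_{k=1}^\infty\subset\mathcal{D}$ such that for every $k\ge1$ $$\mathcal{N}(u_k)\ge(\log u_k)^k.$$ For instance, there exists such a sequence with $u_k\le\exp\left(O(k(\log k)^2)\right)$ and $\omega(u_k)=O(k\log k)$.
   Context: A full-rank lattice $\Lambda\subset\mathbb{R}^2$ has minimum $|\Lambda|=\min_{0\ne x\in\Lambda}\|x\|$ (Euclidean norm) and set of minimal vectors $S(\Lambda)=\{x\in\Lambda:\|x\|=|\Lambda|\}$; it is well-rounded if $S(\Lambda)$ spans $\mathbb{R}^2$. $\mathrm{WR}(\mathbb{Z}^2)$ is the set of all full-rank well-rounded sublattices of $\mathbb{Z}^2$; $\mathcal{D}=\{\det(\Lambda):\Lambda\in\mathrm{WR}(\mathbb{Z}^2)\}$; $\mathcal{N}(u)$ is the number of lattices in $\mathrm{WR}(\mathbb{Z}^2)$ with determinant (covolume) $u$. $\tau(u)$ is the number of positive divisors of $u$ and $\omega(u)$ the number of distinct prime divisors of $u$. A set $\mathcal{P}$ of positive integers has asymptotic density $0$ if $\lim_{M\to\infty}\frac1M|\{n\in\mathcal{P}:n\le M\}|=0$. All implied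 constants in $O(\cdot)$ are absolute; an assertion $f\le O(g)$ or $f<O(g)$ means that $f\le Cg$ for some absolute constant $C>0$, and a chain $f\le O(g)\le O(h)$ means $f\le Cg$ and $g\le C'h$ for absolute constants $C,C'>0$. For $u=1$ (where $\omega(u)=0$) the expression $\left(\frac{\sqrt2\log u}{\omega(u)}\right)^{2\omega(u)}$ is read as $1$. *)

theory Defs
  imports "HOL-Analysis.Analysis" "HOL-Computational_Algebra.Computational_Algebra"
begin

section \<open>Lattices in Euclidean space\<close>

definition int_vectors :: "(real ^ 'n) set"
  where "int_vectors = {z. \<forall>i. z $ i \<in> \<int>}"

text \<open>The columns of \<open>A\<close> form a basis of the lattice \<open>L\<close>.\<close>
definition lattice_basis :: "real ^ 'n ^ 'n \<Rightarrow> (real ^ 'n) set \<Rightarrow> bool"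
  where "lattice_basis A L \<longleftrightarrow> invertible A \<and> L = (\<lambda>z. A *v z) ` int_vectors"

definition full_rank_lattice :: "(real ^ 'n) set \<Rightarrow> bool"
  where "full_rank_lattice L \<longleftrightarrow> (\<exists>A. lattice_basis A L)"

definition covolume :: "(real ^ 'n) set \<Rightarrow> real"
  where "covolume L = (THE d. \<exists>A. lattice_basis A L \<and> d = \<bar>det A\<bar>)"

definition lattice_min :: "(real ^ 'n) set \<Rightarrow> real"
  where "lattice_min L = (LEAST r. r \<in> norm ` (L - {0}))"

definition minimal_vectors :: "(real ^ 'n) set \<Rightarrow> (real ^ 'n) set"
  where "minimal_vectors L = {x \<in> L. norm x = lattice_min L}"

definition well_rounded :: "(real ^ 'n) set \<Rightarrow> bool"
  where "well_rounded L \<longleftrightarrow> span (minimal_vectors L) = UNIV"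

definition WR_Z2 :: "(real ^ 2) set set"
  where "WR_Z2 = {L. full_rank_lattice L \<and> L \<subseteq> int_vectors \<and> well_rounded L}"

definition WR_dets :: "real set"
  where "WR_dets = covolume ` WR_Z2"

text \<open>The set counted here is finite, see \<open>finite_WR_Z2_covolume\<close> below, so that
  \<^const>\<open>card\<close> is the genuine number of lattices.\<close>
definition WR_count :: "nat \<Rightarrow> nat"
  where "WR_count u = card {L \<in> WR_Z2. covolume L = real u}"

section \<open>Arithmetic functions and density\<close>

definition num_divisors :: "nat \<Rightarrow> nat"
  where "num_divisors u = card {d. d dvd u}"

definition num_prime_divisors :: "nat \<Rightarrow> nat"
  where "num_prime_divisors u = card {p. prime p \<and> p dvd u}"

definition density_zero :: "nat set \<Rightarrow> bool"
  where "density_zero P \<longleftrightarrow> (\<lambda>M. real (card {n \<in> P. n \<le> M}) / real M) \<longlonglongrightarrow> 0"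

section \<open>Well-definedness of the covolume and finiteness of the counts\<close>

lemma det_int_matrix:
  fixes U :: "real ^ 'n ^ 'n"
  assumes "\<And>i j. U $ i $ j \<in> \<int>"
  shows "det U \<in> \<int>"
  unfolding det_def by (intro Ints_sum Ints_mult Ints_prod Ints_of_int assms)

lemma lattice_basis_det_le:
  fixes A B :: "real ^ 'n ^ 'n"
  assumes A: "lattice_basis A L" and B: "lattice_basis B L"
  shows "\<bar>det B\<bar> \<le> \<bar>det A\<bar>"
proof -
  have "\<exists>z \<in> int_vectors. column j A = B *v z" for j
  proof -
    have "(axis j 1 :: real ^ 'n) \<in> int_vectors"
      by (auto simp: int_vectors_def axis_def)
    hence "A *v axis j 1 \<in> L"
      using A by (auto simp: lattice_basis_def)
    thus ?thesis
      using B by (auto simp: lattice_basis_def matrix_vector_mult_basis)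
  qed
  then obtain z where z: "\<And>j. z j \<in> int_vectors" "\<And>j. column j A = B *v z j"
    by metis
  define U :: "real ^ 'n ^ 'n" where "U = (\<chi> i j. z j $ i)"
  have "A = B ** U"
    using z(2) by (simp add: U_def vec_eq_iff column_def matrix_matrix_mult_def
        matrix_vector_mult_def)
  hence det: "det A = det B * det U"
    by (simp add: det_mul)
  have "det U \<in> \<int>"
    by (rule det_int_matrix) (use z(1) in \<open>auto simp: U_def int_vectors_def\<close>)
  moreover have "det U \<noteq> 0"
    using A det by (auto simp: lattice_basis_def invertible_det_nz)
  ultimately have "1 \<le> \<bar>det U\<bar>"
    by (rule Ints_nonzero_abs_ge1)
  thus ?thesis
    using mult_left_mono[of 1 "\<bar>det U\<bar>" "\<bar>det B\<bar>"] by (simp add: det abs_mult)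
qed

lemma covolume_eq:
  assumes "lattice_basis A L"
  shows "covolume L = \<bar>det A\<bar>"
  unfolding covolume_def
  by (rule the_equality) (use assms lattice_basis_det_le in \<open>auto intro: order_antisym\<close>)

lemma covolume_pos: "full_rank_lattice L \<Longrightarrow> covolume L > 0"
  by (auto simp: full_rank_lattice_def lattice_basis_def covolume_eq invertible_det_nz)

lemma lattice_closed:
  fixes L :: "(real ^ 'n) set"
  assumes "full_rank_lattice L" "x \<in> L" "y \<in> L"
  shows "x + y \<in> L" "x - y \<in> L"
proof -
  obtain A :: "real ^ 'n ^ 'n" where A: "L = (\<lambda>z. A *v z) ` int_vectors"
    using assms(1) unfolding full_rank_lattice_def lattice_basis_def by blast
  moreover obtain z w
    where "z \<in> int_vectors" "x = A *v z" "w \<in> int_vectors" "y = A *v w"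
    using assms(2,3) unfolding A by blast
  moreover from this have "z + w \<in> int_vectors" "z - w \<in> int_vectors"
    by (auto simp: int_vectors_def)
  ultimately show "x + y \<in> L" "x - y \<in> L"
    by (metis image_eqI matrix_vector_right_distrib matrix_vector_mult_diff_distrib)+
qed

lemma scaled_int_vectors_subset:
  fixes L :: "(real ^ 2) set"
  assumes L: "full_rank_lattice L" "L \<subseteq> int_vectors" and z: "z \<in> int_vectors"
  shows "covolume L *\<^sub>R z \<in> L"
proof -
  obtain A where A: "lattice_basis A L"
    using L by (auto simp: full_rank_lattice_def)
  have A_int: "A $ i $ j \<in> \<int>" for i j
  proof -
    have "(axis j 1 :: real ^ 2) \<in> int_vectors"
      by (auto simp: int_vectors_def axis_def)
    hence "A *v axis j 1 \<in> int_vectors"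
      using A L by (auto simp: lattice_basis_def)
    thus ?thesis
      by (simp add: matrix_vector_mult_basis int_vectors_def column_def)
  qed
  define w :: "real ^ 2" where
    "w = (\<chi> i. sgn (det A) * (if i = 1 then A$2$2 * z$1 - A$1$2 * z$2
                                       else A$1$1 * z$2 - A$2$1 * z$1))"
  have "sgn (det A) \<in> \<int>"
    by (simp add: sgn_if)
  hence "w \<in> int_vectors"
    using A_int z by (auto simp: w_def int_vectors_def)
  moreover have "A *v w = covolume L *\<^sub>R z"
    unfolding covolume_eq[OF A] abs_sgn[of "det A"]
    by (simp add: vec_eq_iff forall_2 matrix_vector_mult_def sum_2 w_def det_2 algebra_simps)
  ultimately show ?thesis
    using A by (metis lattice_basis_def image_eqI)
qed

lemma finite_sublattices_covolume:
  "finite {L :: (real ^ 2) set. full_rank_lattice L \<and> L \<subseteq> int_vectors \<and> covolume L = real u}"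
    (is "finite ?S")
proof -
  define Q :: "(real ^ 2) set" where
    "Q = (\<lambda>(a, b). vector [real a, real b]) ` ({..u} \<times> {..u})"
  have "finite Q"
    by (simp add: Q_def)
  have "inj_on (\<lambda>L. L \<inter> Q) ?S"
  proof (rule inj_onI)
    have sub: "L \<subseteq> L'" if L: "L \<in> ?S" and L': "L' \<in> ?S" and eq: "L \<inter> Q = L' \<inter> Q" for L L'
    proof
      fix x assume x: "x \<in> L"
      have u: "u > 0"
        using L covolume_pos[of L] by auto
      have "\<forall>i. \<exists>m :: int. x $ i = of_int m"
        using x L by (fastforce simp: int_vectors_def elim: Ints_cases)
      then obtain m :: "2 \<Rightarrow> int" where m: "\<And>i. x $ i = of_int (m i)"
        by metis
      define q :: "real ^ 2" where "q = (\<chi> i. of_int (m i div int u))"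
      define y where "y = x - real u *\<^sub>R q"
      have q: "q \<in> int_vectors"
        by (simp add: q_def int_vectors_def)
      have uq: "real u *\<^sub>R q \<in> L" "real u *\<^sub>R q \<in> L'"
        using scaled_int_vectors_subset[OF _ _ q, of L]
          scaled_int_vectors_subset[OF _ _ q, of L'] L L' by auto
      have yi: "y $ i = real (nat (m i mod int u))" for i
      proof -
        have "y $ i = of_int (m i - int u * (m i div int u))"
          by (simp add: y_def q_def m)
        also have "\<dots> = of_int (m i mod int u)"
          by (simp add: minus_mult_div_eq_mod)
        finally show ?thesis
          using u by simp
      qed
      have "nat (m i mod int u) \<le> u" for i
        using u pos_mod_bound[of "int u" "m i"] by linarith
      moreover have "y = vector [real (nat (m 1 mod int u)), real (nat (m 2 mod int u))]"
        by (simp add: vec_eq_iff forall_2 yi)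
      ultimately have "y \<in> Q"
        unfolding Q_def by (intro image_eqI[of _ _ "(nat (m 1 mod int u), nat (m 2 mod int u))"]) auto
      moreover have "y \<in> L"
        unfolding y_def using L x uq by (intro lattice_closed) auto
      ultimately have "y \<in> L'"
        using eq by auto
      hence "y + real u *\<^sub>R q \<in> L'"
        using L' uq by (intro lattice_closed) auto
      thus "x \<in> L'"
        by (simp add: y_def)
    qed
    fix L L' assume "L \<in> ?S" "L' \<in> ?S" "L \<inter> Q = L' \<inter> Q"
    thus "L = L'"
      using sub[of L L'] sub[of L' L] by auto
  qed
  moreover have "(\<lambda>L. L \<inter> Q) ` ?S \<subseteq> Pow Q"
    by auto
  ultimately show ?thesis
    using \<open>finite Q\<close> by (meson finite_Pow_iff inj_on_finite)
qed

lemma finite_WR_Z2_covolume: "finite {L \<in> WR_Z2. covolume L = real u}"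
  by (rule finite_subset[OF _ finite_sublattices_covolume[of u]]) (auto simp: WR_Z2_def)

end

theory Submission
  imports Defs "HOL-Real_Asymp.Real_Asymp"
begin

text \<open>
  Two independent minimal vectors \<open>x, y\<close> of a planar lattice form a basis, and \<open>x + y\<close> is orthogonal
  to \<open>x - y\<close>. A well-rounded sublattice of the integer lattice is therefore encoded by positive
  \<open>a, b\<close> and a primitive \<open>(m, n)\<close> with \<open>x + y = a (m, n)\<close>, \<open>x - y = b (-n, m)\<close> and
  \<open>a b (m\<^sup>2 + n\<^sup>2) = 2 u\<close>, where \<open>u\<close> is the determinant. For fixed \<open>u\<close> there are at most
  \<open>\<tau>(2u)\<^sup>2\<close> pairs \<open>(a, b)\<close>, and a number \<open>N\<close> has at most \<open>4 \<cdot> 2\<close>-to-the-\<open>\<omega>(N)\<close> primitive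
  representations as a sum of two squares. The comparison with \<open>log u\<close> is the AM-GM inequality.

  Counting all tuples with \<open>a b (m\<^sup>2 + n\<^sup>2) \<le> 2 M\<close> bounds the sum of the counts over \<open>u \<le> M\<close> by
  \<open>O(M (log M)\<^sup>2)\<close>. Since \<open>log 8 > 2\<close>, Markov's inequality already shows that the counts exceed
  \<open>(log u)\<close>-to-the-\<open>log 8\<close> only on a set of density zero.

  For large counts, take a product \<open>w\<close> of \<open>r\<close> primes below \<open>r\<^sup>2\<close>. Its \<open>2\<close>-to-the-\<open>r\<close> divisors
  \<open>a\<close> fall into few windows according to the size of \<open>a\<^sup>2 / w\<close> on a logarithmic scale with base 3,
  so for some power \<open>q\<close> of 3 many factorisations \<open>q w = a b\<close> have
  \<open>1/3 \<le> a\<^sup>2 / b\<^sup>2 \<le> 3\<close>; each of them gives the well-rounded lattice with basis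
  \<open>(a, b), (a, -b)\<close>. Multiplying \<open>a\<close> and \<open>b\<close> by a common power of 2 places the determinants in
  disjoint intervals.
\<close>

no_notation fps_nth (infixl "$" 75)

section \<open>Primitive representations as a sum of two squares\<close>

lemma coprime_dvd_sum_squares:
  fixes m n :: int
  assumes "coprime m n" "prime p" "p dvd m\<^sup>2 + n\<^sup>2"
  shows "\<not> p dvd m" "\<not> p dvd n"
proof -
  have "p dvd m \<longleftrightarrow> p dvd n"
    using assms(2,3) by (metis dvd_add_right_iff dvd_add_left_iff prime_dvd_power_iff zero_less_numeral)
  moreover have "\<not> (p dvd m \<and> p dvd n)"
    using assms(1,2) by (meson coprime_common_divisor not_prime_unit)
  ultimately show "\<not> p dvd m" "\<not> p dvd n" by auto
qed

lemma prime_power_dvd_mult_cases: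
  fixes a b p :: int
  assumes "prime p" "p ^ k dvd a * b" "\<not> (p dvd a \<and> p dvd b)"
  shows "p ^ k dvd a \<or> p ^ k dvd b"
proof -
  have "coprime p a \<or> coprime p b"
    using assms(1,3) by (meson prime_imp_coprime)
  thus ?thesis
    using assms(2) by (metis coprime_dvd_mult_left_iff coprime_dvd_mult_right_iff coprime_power_left_iff)
qed

text \<open>Coprime \<open>m\<close>, \<open>n\<close> with an even sum of squares are both odd, and
  two odd squares add up to 2 modulo 4. So the prime 2 enters a primitively represented number at
  most once.\<close>

lemma not_4_dvd_sum_squares:
  fixes m n :: int
  assumes "coprime m n"
  shows "\<not> 4 dvd m\<^sup>2 + n\<^sup>2"
proof
  assume d: "4 dvd m\<^sup>2 + n\<^sup>2"
  have "(2::int) dvd 4" by simp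
  from this d have "2 dvd m\<^sup>2 + n\<^sup>2" by (rule dvd_trans)
  have two_prime: "prime (2::int)" by simp
  from \<open>2 dvd m\<^sup>2 + n\<^sup>2\<close> have odd: "odd m" "odd n"
    using coprime_dvd_sum_squares[OF assms, of 2, OF two_prime] \<open>2 dvd m\<^sup>2 + n\<^sup>2\<close> by blast+
  define s t where "s = m div 2" and "t = n div 2"
  have mn: "m = 2 * s + 1" "n = 2 * t + 1"
    using odd by (simp_all add: s_def t_def)
  have "m\<^sup>2 + n\<^sup>2 = 4 * (s\<^sup>2 + s + t\<^sup>2 + t) + 2"
    unfolding mn by (simp add: power2_eq_square algebra_simps)
  with d have "4 dvd 4 * (s\<^sup>2 + s + t\<^sup>2 + t) + 2" by (simp only:)
  moreover have "\<not> 4 dvd 4 * x + 2" for x :: int by presburger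
  ultimately show False by (simp only: not_True_eq_False)
qed

text \<open>Informally, both divisibilities say that \<open>m/n\<close> and \<open>m'/n'\<close>
  equal \<open>e\<close> times \<open>m0/n0\<close> modulo \<open>q\<close>. Eliminating the common
  ratio leaves \<open>n0\<close> times the cross product, and \<open>n0\<close> cancels modulo
  \<open>q\<close>. The sign \<open>e\<close> is 1 or -1 in the application.\<close>

lemma dvd_cross_of_dvd_cross:
  fixes m n m' n' m0 n0 e q :: int
  assumes "coprime q n0" "q dvd m * n0 - e * (m0 * n)" "q dvd m' * n0 - e * (m0 * n')"
  shows "q dvd m * n' - m' * n"
proof -
  have "q dvd (m * n0 - e * (m0 * n)) * n' - (m' * n0 - e * (m0 * n')) * n"
    by (intro dvd_diff dvd_mult2 assms)
  also have "\<dots> = n0 * (m * n' - m' * n)" by (simp add: algebra_simps)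
  finally show ?thesis using assms(1) by (simp add: coprime_dvd_mult_right_iff)
qed

text \<open>Relative to a fixed representation \<open>(m0, n0)\<close>, each odd prime power exactly dividing \<open>N\<close>
  divides exactly one of \<open>m n0 - m0 n\<close> and \<open>m n0 + m0 n\<close>; the set of primes of the first kind
  therefore determines \<open>m/n\<close> modulo \<open>N\<close>.\<close>
lemma sum_squares_dvd_cross:
  fixes m n m' n' m0 n0 N :: int
  assumes "N > 0" and c: "coprime m n" "coprime m' n'" "coprime m0 n0"
    and eq: "m\<^sup>2 + n\<^sup>2 = N" "m'\<^sup>2 + n'\<^sup>2 = N" "m0\<^sup>2 + n0\<^sup>2 = N"
    and S: "{p. prime p \<and> p dvd N \<and> p dvd m * n0 - m0 * n} = {p. prime p \<and> p dvd N \<and> p dvd m' * n0 - m0 * n'}"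
  shows "N dvd m * n' - m' * n"
\<comment> \<open>The multiplicity of a prime in 0 is 0 by convention, so a vanishing cross product
  is split off before multiplicities are compared.\<close>
proof (cases "m * n' - m' * n = 0")
  case True
  show ?thesis unfolding True by (rule dvd_0_right)
next
  case nz: False
  show ?thesis
  proof (rule multiplicity_le_imp_dvd)
    show "N \<noteq> 0" using \<open>N > 0\<close> by simp
    fix p :: int assume p: "prime p"
    show "multiplicity p N \<le> multiplicity p (m * n' - m' * n)"
    proof (cases "p dvd N")
      case False
      thus ?thesis by (simp add: not_dvd_imp_multiplicity_0)
    next
      case pN: True
      define q where "q = p ^ multiplicity p N"
      have qN: "q dvd N" unfolding q_def by (rule multiplicity_dvd)
      have nd: "\<not> p dvd m" "\<not> p dvd n" "\<not> p dvd m'" "\<not> p dvd n'" "\<not> p dvd m0" "\<not> p dvd n0"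
        using coprime_dvd_sum_squares[OF c(1) p]
          coprime_dvd_sum_squares[OF c(2) p]
          coprime_dvd_sum_squares[OF c(3) p] pN eq by auto
      have "q dvd m * n' - m' * n"
      proof (cases "p = 2")
        case True
        \<comment> \<open>At 2 the two cross terms are both even and cannot be told apart. Since 4
          does not divide \<open>N\<close>, parity alone suffices here.\<close>
        have "multiplicity 2 N \<le> 1"
        proof (rule ccontr)
          assume "\<not> multiplicity 2 N \<le> 1"
          hence "(2::int) ^ 2 dvd N" by (intro multiplicity_dvd') auto
          thus False using not_4_dvd_sum_squares[OF c(1)] eq by simp
        qed
        hence "q dvd 2 ^ 1" unfolding q_def True by (intro le_imp_power_dvd)
        moreover have "2 dvd m * n' - m' * n" using nd True by auto
        ultimately show ?thesis by (metis dvd_trans power_one_right)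
      next
        case odd: False
        \<comment> \<open>The product of the two cross terms is a multiple of \<open>N\<close>. An
          odd prime dividing both would divide their sum \<open>2 * (m * n0)\<close>, so the whole
          power \<open>q\<close> falls on exactly one of them.\<close>
        have *: "(q dvd m * n0 - m0 * n \<and> p dvd m * n0 - m0 * n) \<or> (q dvd m * n0 + m0 * n \<and> \<not> p dvd m * n0 - m0 * n)"
          if eq: "m\<^sup>2 + n\<^sup>2 = N" and nd: "\<not> p dvd m" for m n
        proof -
          have "(m * n0 - m0 * n) * (m * n0 + m0 * n) = N * (n0\<^sup>2 - n\<^sup>2)"
          proof -
            have "(m * n0 - m0 * n) * (m * n0 + m0 * n) = m\<^sup>2 * n0\<^sup>2 - m0\<^sup>2 * n\<^sup>2"
              by (simp add: power2_eq_square algebra_simps)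
            moreover have "m\<^sup>2 = N - n\<^sup>2" "m0\<^sup>2 = N - n0\<^sup>2"
              using eq \<open>m0\<^sup>2 + n0\<^sup>2 = N\<close> by auto
            ultimately show ?thesis
              by (simp add: algebra_simps)
          qed
          hence "q dvd (m * n0 - m0 * n) * (m * n0 + m0 * n)" using qN by simp
          moreover have "\<not> (p dvd m * n0 - m0 * n \<and> p dvd m * n0 + m0 * n)"
          proof
            assume "p dvd m * n0 - m0 * n \<and> p dvd m * n0 + m0 * n"
            hence "p dvd (m * n0 - m0 * n) + (m * n0 + m0 * n)" by (elim conjE) (rule dvd_add)
            also have "\<dots> = 2 * (m * n0)" by simp
            finally have "p dvd 2" using p nd \<open>\<not> p dvd n0\<close> by (auto simp: prime_dvd_mult_iff)
            moreover have "prime (2::int)" by simp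
            ultimately show False using odd p by (metis primes_dvd_imp_eq)
          qed
          moreover have "p dvd q" using pN \<open>N > 0\<close> p unfolding q_def
            by (intro dvd_power) (auto simp: prime_multiplicity_gt_zero_iff)
          ultimately show ?thesis
            using prime_power_dvd_mult_cases[OF p] unfolding q_def by (meson dvd_trans)
        qed
        have cq: "coprime q n0" unfolding q_def using nd p by (simp add: prime_imp_coprime)
        have "p \<in> {p. prime p \<and> p dvd N \<and> p dvd m * n0 - m0 * n} \<longleftrightarrow> p \<in> {p. prime p \<and> p dvd N \<and> p dvd m' * n0 - m0 * n'}"
          by (simp only: S)
        hence "p dvd m * n0 - m0 * n \<longleftrightarrow> p dvd m' * n0 - m0 * n'" using p pN by simp
        with *[OF eq(1) nd(1)] *[OF eq(2) nd(3)]
        consider "q dvd m * n0 - m0 * n" "q dvd m' * n0 - m0 * n'"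
          | "q dvd m * n0 + m0 * n" "q dvd m' * n0 + m0 * n'"
          by blast
        thus ?thesis
          using dvd_cross_of_dvd_cross[OF cq, of m 1 m0 n m' n'] dvd_cross_of_dvd_cross[OF cq, of m "-1" m0 n m' n']
          by cases simp_all
      qed
      thus ?thesis using nz p unfolding q_def by (intro multiplicity_geI) auto
    qed
  qed
qed

section \<open>Counting primitive representations up to the four Gaussian units\<close>

definition prim_reps :: "int \<Rightarrow> (int \<times> int) set" where
  "prim_reps N = {(m, n). coprime m n \<and> m\<^sup>2 + n\<^sup>2 = N}"

lemma square_le_imp_abs_le: "(x::int)\<^sup>2 \<le> N \<Longrightarrow> \<bar>x\<bar> \<le> N"
proof -
  assume x: "x\<^sup>2 \<le> N"
  have "\<bar>x\<bar> \<le> x\<^sup>2"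
    using self_le_power[of "\<bar>x\<bar>" 2] by (cases "x = 0") simp_all
  also have "\<dots> \<le> N" by fact
  finally show ?thesis .
qed

lemma finite_prim_reps: "finite (prim_reps N)"
proof (rule finite_subset)
  show "prim_reps N \<subseteq> {-N..N} \<times> {-N..N}"
  proof (clarsimp simp: prim_reps_def)
    fix m n :: int
    have "\<bar>m\<bar> \<le> m\<^sup>2 + n\<^sup>2" "\<bar>n\<bar> \<le> m\<^sup>2 + n\<^sup>2"
      using square_le_imp_abs_le[of m "m\<^sup>2 + n\<^sup>2"] square_le_imp_abs_le[of n "m\<^sup>2 + n\<^sup>2"] by simp_all
    thus "- (m\<^sup>2) - n\<^sup>2 \<le> m \<and> m \<le> m\<^sup>2 + n\<^sup>2 \<and> - (m\<^sup>2) - n\<^sup>2 \<le> n \<and> n \<le> m\<^sup>2 + n\<^sup>2"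
      by linarith
  qed
qed auto

text \<open>In Gaussian integers, \<open>e + d i\<close> is the product of the conjugate of
  \<open>m + n i\<close> with \<open>m' + n' i\<close>, and it has norm \<open>N\<close> squared. If
  \<open>N\<close> divides \<open>d\<close>, then one of \<open>d\<close>, \<open>e\<close> vanishes
  and the other is \<open>N\<close> up to sign, so the two representations differ by a unit 1, -1, i
  or -i.\<close>

lemma prim_reps_dvd_cross_cases:
  assumes "N > 0" "(m, n) \<in> prim_reps N" "(m', n') \<in> prim_reps N" "N dvd m * n' - m' * n"
  shows "(m', n') \<in> {(m, n), (-m, -n), (n, -m), (-n, m)}"
proof -
  define d where "d = m * n' - m' * n"
  define e where "e = m * m' + n * n'"
  have eq: "m\<^sup>2 + n\<^sup>2 = N" "m'\<^sup>2 + n'\<^sup>2 = N" using assms by (auto simp: prim_reps_def)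
  have "d\<^sup>2 + e\<^sup>2 = (m\<^sup>2 + n\<^sup>2) * (m'\<^sup>2 + n'\<^sup>2)"
    by (simp add: d_def e_def power2_eq_square algebra_simps)
  hence de: "d\<^sup>2 + e\<^sup>2 = N\<^sup>2"
    by (simp only: eq power2_eq_square[of N])
  have m': "N * m' = m * e - n * d" and n': "N * n' = n * e + m * d"
    by (simp_all add: d_def e_def eq(1)[symmetric] power2_eq_square algebra_simps)
  obtain k where k: "d = N * k" using assms(4) unfolding d_def by auto
  have "d\<^sup>2 \<le> N\<^sup>2" using de by (smt (verit) zero_le_power2)
  hence "\<bar>d\<bar> \<le> N" using \<open>N > 0\<close> by (simp add: abs_le_square_iff[symmetric])
  hence "N * \<bar>k\<bar> \<le> N * 1" using \<open>N > 0\<close> by (simp add: k abs_mult)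
  hence "\<bar>k\<bar> \<le> 1" using \<open>N > 0\<close> by (simp only: mult_le_cancel_left_pos)
  then consider "k = 0" | "k = 1" | "k = -1" by linarith
  hence "(d = 0 \<and> (e = N \<or> e = -N)) \<or> (e = 0 \<and> (d = N \<or> d = -N))"
    using de by cases (auto simp: k power2_eq_iff)
  thus ?thesis
  proof (elim disjE conjE)
    assume "d = 0" "e = N"
    hence "N * m' = N * m" "N * n' = N * n" using m' n' by (simp_all add: mult.commute)
    thus ?thesis using \<open>N > 0\<close> by simp
  next
    assume "d = 0" "e = -N"
    hence "N * m' = N * (-m)" "N * n' = N * (-n)" using m' n' by (simp_all add: mult.commute)
    thus ?thesis using \<open>N > 0\<close> unfolding mult_cancel_left by simp
  next
    assume "e = 0" "d = N"
    hence "N * m' = N * (-n)" "N * n' = N * m" using m' n' by (simp_all add: mult.commute)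
    thus ?thesis using \<open>N > 0\<close> unfolding mult_cancel_left by simp
  next
    assume "e = 0" "d = -N"
    hence "N * m' = N * n" "N * n' = N * (-m)" using m' n' by (simp_all add: mult.commute)
    thus ?thesis using \<open>N > 0\<close> unfolding mult_cancel_left by simp
  qed
qed

text \<open>Fix a reference representation and send each representation to the set \<open>S\<close>
  of primes at which it agrees with the reference one. Equal sets force the representations to
  differ by a unit, so each fibre has at most 4 elements, and there are at most as many fibres as
  sets of prime divisors.\<close>

lemma card_prim_reps_le:
  assumes "N > 0"
  shows "card (prim_reps N) \<le> 4 * 2 ^ card {p::int. prime p \<and> p dvd N}"
proof (cases "prim_reps N = {}")
  case False
  then obtain m0 n0 where 0: "(m0, n0) \<in> prim_reps N" by auto
  define Q where "Q = {p::int. prime p \<and> p dvd N}"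
  define S where "S = (\<lambda>(m, n). {p. prime p \<and> p dvd N \<and> p dvd m * n0 - m0 * n})"
  have "Q \<subseteq> {0..N}"
    using \<open>N > 0\<close> by (auto simp: Q_def prime_ge_0_int zdvd_imp_le)
  hence fQ: "finite Q" by (rule finite_subset) simp
  have fib: "card {x \<in> prim_reps N. S x = T} \<le> 4" for T
  proof (cases "\<exists>x\<in>prim_reps N. S x = T")
    case True
    then obtain m n where x: "(m, n) \<in> prim_reps N" "S (m, n) = T" by auto
    have "{x \<in> prim_reps N. S x = T} \<subseteq> {(m, n), (-m, -n), (n, -m), (-n, m)}"
    proof
      fix z assume "z \<in> {x \<in> prim_reps N. S x = T}"
      then obtain m' n' where z: "z = (m', n')" and y: "(m', n') \<in> prim_reps N" "S (m', n') = T"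
        by (cases z) auto
      have "N dvd m * n' - m' * n"
        using x y 0 \<open>N > 0\<close> by (intro sum_squares_dvd_cross[of N m n m' n' m0 n0])
          (auto simp: prim_reps_def S_def)
      with prim_reps_dvd_cross_cases[OF \<open>N > 0\<close> x(1) y(1)]
      show "z \<in> {(m, n), (-m, -n), (n, -m), (-n, m)}" unfolding z by blast
    qed
    from card_mono[OF _ this] show ?thesis
      using card_length[of "[(m, n), (-m, -n), (n, -m), (-n, m)]"] by (simp add: order_trans)
  next
    case False
    hence "{x \<in> prim_reps N. S x = T} = {}" by auto
    thus ?thesis by (simp only: card.empty)
  qed
  have SQ: "S x \<in> Pow Q" for x
    by (cases x) (simp add: S_def Q_def Collect_mono)
  have "prim_reps N = (\<Union>T\<in>Pow Q. {x \<in> prim_reps N. S x = T})"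
    using SQ by blast
  also have "card \<dots> \<le> (\<Sum>T\<in>Pow Q. card {x \<in> prim_reps N. S x = T})"
    using fQ by (intro card_UN_le) auto
  also have "\<dots> \<le> (\<Sum>T\<in>Pow Q. 4)"
    by (intro sum_mono fib)
  also have "\<dots> = 4 * 2 ^ card Q"
    using fQ by (simp add: card_Pow)
  finally show ?thesis unfolding Q_def .
qed auto

section \<open>Divisor bounds\<close>

lemma finite_prime_divisors: "u > 0 \<Longrightarrow> finite {p::nat. prime p \<and> p dvd u}"
  by (rule finite_subset[of _ "{..u}"]) (auto intro: dvd_imp_le)

lemma num_prime_divisors_mult_le:
  assumes "a > 0" "b > 0"
  shows "num_prime_divisors (a * b) \<le> num_prime_divisors a + num_prime_divisors b"
proof -
  have "{p. prime p \<and> p dvd a * b} \<subseteq> {p. prime p \<and> p dvd a} \<union> {p. prime p \<and> p dvd b}"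
    by (auto simp: prime_dvd_mult_iff)
  hence "num_prime_divisors (a * b) \<le> card ({p. prime p \<and> p dvd a} \<union> {p. prime p \<and> p dvd b})"
    unfolding num_prime_divisors_def using assms by (intro card_mono) (auto simp: finite_prime_divisors)
  also have "\<dots> \<le> num_prime_divisors a + num_prime_divisors b"
    unfolding num_prime_divisors_def by (rule card_Un_le)
  finally show ?thesis .
qed

lemma num_prime_divisors_prime_power_le:
  assumes "prime p"
  shows "num_prime_divisors (p ^ k) \<le> 1"
proof -
  have "{q. prime q \<and> q dvd p ^ k} \<subseteq> {p}"
    using assms by (auto dest: prime_dvd_power primes_dvd_imp_eq)
  from card_mono[OF _ this] show ?thesis by (simp add: num_prime_divisors_def)
qed

text \<open>An odd divisor of \<open>2 * u\<close> divides \<open>u\<close>, and an even one is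
  twice a divisor of \<open>u\<close>.\<close>

lemma num_divisors_double_le:
  assumes "u > 0"
  shows "num_divisors (2 * u) \<le> 2 * num_divisors u"
proof -
  have "{d. d dvd 2 * u} \<subseteq> {d. d dvd u} \<union> (\<lambda>d. 2 * d) ` {d. d dvd u}"
  proof
    fix d assume d: "d \<in> {d. d dvd 2 * u}"
    show "d \<in> {d. d dvd u} \<union> (\<lambda>d. 2 * d) ` {d. d dvd u}"
    proof (cases "even d")
      case True
      then obtain e where "d = 2 * e" by (rule evenE)
      thus ?thesis using d by auto
    next
      case False
      hence "coprime d 2" by simp
      thus ?thesis using d by (simp add: coprime_dvd_mult_right_iff)
    qed
  qed
  hence "num_divisors (2 * u) \<le> card ({d. d dvd u} \<union> (\<lambda>d. 2 * d) ` {d. d dvd u})"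
    unfolding num_divisors_def using assms by (intro card_mono) auto
  also have "\<dots> \<le> card {d. d dvd u} + card ((\<lambda>d. 2 * d) ` {d. d dvd u})"
    by (rule card_Un_le)
  also have "\<dots> \<le> card {d. d dvd u} + card {d. d dvd u}"
    using assms by (intro add_left_mono card_image_le) auto
  finally show ?thesis by (simp add: num_divisors_def)
qed

text \<open>The lattice encoded by \<open>(a, b, m, n)\<close> has a basis \<open>x, y\<close> with \<open>x + y = a (m, n)\<close> and
  \<open>x - y = b (-n, m)\<close>, see \<open>params_lattice\<close> below.\<close>
definition wr_params :: "nat \<Rightarrow> (nat \<times> nat \<times> int \<times> int) set" where
  "wr_params u = {(a, b, m, n). a > 0 \<and> b > 0 \<and> coprime m n \<and>
     int a * int b * (m\<^sup>2 + n\<^sup>2) = 2 * int u}"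

lemma card_prime_divisors_int_le:
  assumes "N > 0" "N dvd int v" "v > 0"
  shows "card {p::int. prime p \<and> p dvd N} \<le> num_prime_divisors v"
proof -
  have "{p::int. prime p \<and> p dvd N} \<subseteq> int ` {p. prime p \<and> p dvd v}"
  proof
    fix p :: int assume p: "p \<in> {p. prime p \<and> p dvd N}"
    then obtain q where q: "p = int q" by (metis mem_Collect_eq prime_ge_0_int nonneg_int_cases)
    have "int q dvd int v" using p assms(2) unfolding q by (blast intro: dvd_trans)
    hence "q \<in> {p. prime p \<and> p dvd v}" using p by (simp add: q)
    thus "p \<in> int ` {p. prime p \<and> p dvd v}" unfolding q by (rule imageI)
  qed
  hence "card {p::int. prime p \<and> p dvd N} \<le> card (int ` {p. prime p \<and> p dvd v})"
    using assms(3) by (intro card_mono) (auto simp: finite_prime_divisors)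
  also have "\<dots> \<le> num_prime_divisors v"
    unfolding num_prime_divisors_def using assms(3) by (intro card_image_le finite_prime_divisors)
  finally show ?thesis .
qed

text \<open>Both \<open>a\<close> and \<open>b\<close> divide \<open>2 * u\<close>, and for a fixed
  pair \<open>(m, n)\<close> is a primitive representation of the cofactor. The constant 32 is 4
  from squaring the doubling loss for divisors, 4 from the units, and 2 from the possible extra
  prime divisor 2.\<close>

lemma wr_params_bound:
  assumes "u > 0"
  shows "finite (wr_params u)"
    and "card (wr_params u) \<le> 32 * (num_divisors u ^ 2 * 2 ^ num_prime_divisors u)"
proof -
  define D where "D = {d. d dvd 2 * u}"
  \<comment> \<open>The divisibility condition empties the fibre whenever \<open>div\<close> would
    round.\<close>
  define R where "R = (\<lambda>(a, b). {mn \<in> prim_reps (2 * int u div (int a * int b)). int a * int b dvd 2 * int u})"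
  have fD: "finite D" unfolding D_def using assms by simp
  have fR: "finite (R x)" for x
    by (cases x) (simp add: R_def finite_prim_reps)
  have sub: "wr_params u \<subseteq> (\<lambda>((a, b), m, n). (a, b, m, n)) ` (SIGMA x:D \<times> D. R x)"
  proof
    fix z assume "z \<in> wr_params u"
    then obtain a b m n where z: "z = (a, b, m, n)" and ab: "a > 0" "b > 0"
      and c: "coprime m n" and eq: "2 * int u = int a * int b * (m\<^sup>2 + n\<^sup>2)"
      by (cases z) (auto simp: wr_params_def)
    have d: "int a dvd int (2 * u)" "int b dvd int (2 * u)" "int a * int b dvd 2 * int u"
      using eq by auto
    hence "a dvd 2 * u" "b dvd 2 * u" by (simp_all only: int_dvd_int_iff)
    moreover have "2 * int u div (int a * int b) = m\<^sup>2 + n\<^sup>2"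
      unfolding eq using ab by simp
    ultimately have "((a, b), m, n) \<in> (SIGMA x:D \<times> D. R x)"
      using d c by (simp add: D_def R_def prim_reps_def)
    thus "z \<in> (\<lambda>((a, b), m, n). (a, b, m, n)) ` (SIGMA x:D \<times> D. R x)"
      unfolding z by (rule rev_image_eqI) simp
  qed
  have fS: "finite (SIGMA x:D \<times> D. R x)" using fD fR by blast
  show "finite (wr_params u)" using sub fS by (rule finite_subset[OF _ finite_imageI])
  have R: "card (R x) \<le> 8 * 2 ^ num_prime_divisors u" for x
  proof -
    obtain a b where x: "x = (a, b)" by (cases x)
    show ?thesis
    proof (cases "int a * int b dvd 2 * int u")
      case True
      define N where "N = 2 * int u div (int a * int b)"
      have eq: "2 * int u = int a * int b * N" using True by (simp add: N_def)
      hence "N * (int a * int b) > 0" using assms by (simp add: mult.commute)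
      hence N: "N > 0" by (rule zero_less_mult_pos2) (use eq assms in \<open>auto intro!: mult_pos_pos Nat.gr0I\<close>)
      have "card (R x) = card (prim_reps N)"
        using True by (simp add: R_def x N_def)
      also have "\<dots> \<le> 4 * 2 ^ card {p::int. prime p \<and> p dvd N}"
        by (rule card_prim_reps_le[OF N])
      also have "card {p::int. prime p \<and> p dvd N} \<le> num_prime_divisors (2 * u)"
        using assms eq by (intro card_prime_divisors_int_le[OF N]) auto
      also have "num_prime_divisors (2 * u) \<le> 1 + num_prime_divisors u"
        using num_prime_divisors_mult_le[of 2 u] num_prime_divisors_prime_power_le[of 2 1] assms by simp
      finally show ?thesis by simp
    qed (simp add: R_def x)
  qed
  have "card (wr_params u) \<le> card (SIGMA x:D \<times> D. R x)"
    by (rule order_trans[OF card_mono[OF finite_imageI[OF fS] sub] card_image_le[OF fS]])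
  also have "\<dots> = (\<Sum>x\<in>D \<times> D. card (R x))"
    using fD fR by (intro card_SigmaI) auto
  also have "\<dots> \<le> (\<Sum>x\<in>D \<times> D. 8 * 2 ^ num_prime_divisors u)"
    by (intro sum_mono R)
  also have "\<dots> = num_divisors (2 * u) ^ 2 * (8 * 2 ^ num_prime_divisors u)"
    by (simp add: card_cartesian_product D_def num_divisors_def power2_eq_square)
  also have "\<dots> \<le> (2 * num_divisors u) ^ 2 * (8 * 2 ^ num_prime_divisors u)"
    by (intro mult_right_mono power_mono num_divisors_double_le assms) auto
  finally show "card (wr_params u) \<le> 32 * (num_divisors u ^ 2 * 2 ^ num_prime_divisors u)"
    by (simp add: power2_eq_square)
qed

section \<open>Bounding the number of divisors by a power of the logarithm\<close>

lemma num_divisors_le_prod: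
  assumes "u > 0"
  shows "num_divisors u \<le> (\<Prod>p\<in>prime_factors u. multiplicity p u + 1)"
proof -
  define f where "f = (\<lambda>d::nat. \<lambda>p\<in>prime_factors u. multiplicity p d)"
  have "inj_on f {d. d dvd u}"
  proof (rule inj_onI)
    fix d e assume de: "d \<in> {d. d dvd u}" "e \<in> {d. d dvd u}" "f d = f e"
    have nz: "d \<noteq> 0" "e \<noteq> 0" using de assms by auto
    have "normalize d = normalize e"
    proof (rule multiplicity_eq_imp_eq[OF nz])
      fix p :: nat assume p: "prime p"
      show "multiplicity p d = multiplicity p e"
      proof (cases "p dvd u")
        case True
        hence "p \<in> prime_factors u" using p assms by (auto simp: prime_factors_dvd)
        thus ?thesis using fun_cong[OF de(3), of p] by (simp add: f_def)
      next
        case False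
        hence "\<not> p dvd d" "\<not> p dvd e" using de by (auto dest: dvd_trans)
        thus ?thesis by (simp add: not_dvd_imp_multiplicity_0)
      qed
    qed
    thus "d = e" by simp
  qed
  moreover have "f ` {d. d dvd u} \<subseteq> (\<Pi>\<^sub>E p\<in>prime_factors u. {..multiplicity p u})"
    using assms by (auto simp: f_def intro!: dvd_imp_multiplicity_le)
  ultimately have "num_divisors u \<le> card (\<Pi>\<^sub>E p\<in>prime_factors u. {..multiplicity p u})"
    unfolding num_divisors_def by (intro card_inj_on_le) (auto intro: finite_PiE)
  thus ?thesis by (simp add: card_PiE)
qed

text \<open>The quantities \<open>x p = e p * ln p\<close> sum to \<open>ln u\<close>, so AM-GM
  bounds their product by the desired power. The number of divisors is at most the product of the
  factors \<open>e p + 1 \<le> 2 * e p\<close>, and \<open>2 * e p \<le> x p\<close> as soon as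
  \<open>ln p \<ge> 2\<close>; the small primes cost a bounded factor.\<close>

lemma num_divisors_le_log:
  assumes "u > 1"
  shows "real (num_divisors u) \<le> 3 ^ 8 * (ln (real u) / real (num_prime_divisors u)) ^ num_prime_divisors u"
proof -
  define P where "P = prime_factors u"
  define e where "e = (\<lambda>p. real (multiplicity p u))"
  define r where "r = card P"
  have r: "num_prime_divisors u = r"
    using assms by (auto simp: num_prime_divisors_def r_def P_def prime_factors_dvd intro: arg_cong[of _ _ card])
  have fP: "finite P" by (simp add: P_def)
  have "P \<noteq> {}" using assms prime_factor_nat[of u] by (auto simp: P_def prime_factors_dvd)
  hence r0: "r > 0" using fP by (auto simp: r_def card_gt_0_iff)
  have p: "prime p" "e p \<ge> 1" if "p \<in> P" for p
  proof -
    show "prime p" using that unfolding P_def by (rule in_prime_factors_imp_prime)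
    hence "multiplicity p u > 0" using that assms by (auto simp: P_def prime_multiplicity_gt_zero_iff prime_factors_dvd)
    thus "e p \<ge> 1" by (simp add: e_def)
  qed
  have ln2: "ln (2::real) \<ge> 2 / 3" by (rule ln2_ge_two_thirds)
  have lnp: "ln (real p) \<ge> 2 / 3" if "p \<in> P" for p
  proof -
    have "ln 2 \<le> ln (real p)" using prime_ge_2_nat[OF p(1)[OF that]] by simp
    thus ?thesis using ln2 by linarith
  qed
  define x where "x = (\<lambda>p. e p * ln (real p))"
  have x0: "x p > 0" if "p \<in> P" for p
    unfolding x_def using p(2)[OF that] lnp[OF that] by (intro mult_pos_pos) linarith+
  have "ln (real u) = (\<Sum>p\<in>P. x p)"
  proof -
    have "real u = (\<Prod>p\<in>P. real p ^ multiplicity p u)"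
      using prod_prime_factors[of u] assms by (simp add: P_def flip: of_nat_power of_nat_prod)
    also have "ln \<dots> = (\<Sum>p\<in>P. ln (real p ^ multiplicity p u))"
      using fP p(1) by (intro ln_prod) (auto simp: prime_gt_0_nat)
    also have "\<dots> = (\<Sum>p\<in>P. x p)"
      using p(1) by (intro sum.cong) (auto simp: x_def e_def ln_realpow prime_gt_0_nat)
    finally show ?thesis .
  qed
  hence "(\<Prod>p\<in>P. x p) powr (1 / real r) \<le> ln (real u) / real r"
    using arith_geom_mean[OF fP \<open>P \<noteq> {}\<close>, of x] x0 by (simp add: r_def less_imp_le sum_divide_distrib)
  hence "((\<Prod>p\<in>P. x p) powr (1 / real r)) ^ r \<le> (ln (real u) / real r) ^ r"
    by (intro power_mono) auto
  moreover have "((\<Prod>p\<in>P. x p) powr (1 / real r)) ^ r = (\<Prod>p\<in>P. x p)"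
    using r0 prod_pos[of P x] x0 by (simp add: powr_realpow[symmetric] powr_powr)
  ultimately have amgm: "(\<Prod>p\<in>P. x p) \<le> (ln (real u) / real r) ^ r" by simp
  \<comment> \<open>From 8 on the logarithm is at least 2, because \<open>3 * ln 2 \<ge> 2\<close>.
    Below 8 the factor 3 repairs \<open>ln p \<ge> 2 / 3\<close>. Counting all eight numbers below 8
    gives \<open>3 ^ 8\<close>.\<close>
  define c :: "nat \<Rightarrow> real" where "c = (\<lambda>p. if p < 8 then 3 else 1)"
  have "real (num_divisors u) \<le> real (\<Prod>p\<in>P. multiplicity p u + 1)"
    unfolding of_nat_le_iff P_def using assms by (intro num_divisors_le_prod) auto
  also have "\<dots> = (\<Prod>p\<in>P. e p + 1)" by (simp add: e_def add.commute)
  also have "\<dots> \<le> (\<Prod>p\<in>P. c p * x p)"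
  proof (rule prod_mono)
    fix q assume q: "q \<in> P"
    have "c q * ln (real q) \<ge> 2"
    proof (cases "q < 8")
      case True
      thus ?thesis using lnp[OF q] by (simp add: c_def)
    next
      case False
      have "2 \<le> 3 * ln (2::real)" using ln2 by simp
      also have "\<dots> = ln (2 ^ 3)" by (subst ln_realpow) auto
      also have "\<dots> \<le> ln (real q)" using False by simp
      finally show ?thesis using False by (simp add: c_def)
    qed
    hence "e q * 2 \<le> e q * (c q * ln (real q))" using p(2)[OF q] by (intro mult_left_mono) auto
    moreover have "c q * x q = e q * (c q * ln (real q))" by (simp add: x_def)
    ultimately show "0 \<le> e q + 1 \<and> e q + 1 \<le> c q * x q" using p(2)[OF q] by linarith
  qed
  also have "\<dots> = (\<Prod>p\<in>P. c p) * (\<Prod>p\<in>P. x p)" by (rule prod.distrib)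
  also have "(\<Prod>p\<in>P. c p) \<le> 3 ^ 8"
  proof -
    have "(\<Prod>p\<in>P. c p) = (\<Prod>p\<in>P \<inter> {..<8}. 3)"
      unfolding c_def using fP by (subst prod.inter_restrict) auto
    also have "\<dots> = 3 ^ card (P \<inter> {..<8})" by simp
    also have "\<dots> \<le> 3 ^ 8"
      using card_mono[of "{..<8}" "P \<inter> {..<8}"] by (intro power_increasing) auto
    finally show ?thesis .
  qed
  also have "3 ^ 8 * (\<Prod>p\<in>P. x p) \<le> 3 ^ 8 * (ln (real u) / real r) ^ r"
    using amgm by (intro mult_left_mono) auto
  finally show ?thesis
    using x0 prod_nonneg[of P x] by (simp add: r less_imp_le mult_right_mono)
qed

text \<open>This is the square of the preceding bound, with \<open>2 ^ r\<close> absorbed as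
  \<open>(sqrt 2) ^ (2 * r)\<close>. For \<open>u = 1\<close> the exponent is 0, so the right-hand
  power is 1, as the convention demands.\<close>

lemma divisor_bound_le_log:
  assumes "u > 0"
  shows "real (num_divisors u) ^ 2 * 2 ^ num_prime_divisors u \<le>
      3 ^ 16 * (sqrt 2 * ln (real u) / real (num_prime_divisors u)) ^ (2 * num_prime_divisors u)"
proof (cases "u = 1")
  case True
  have "num_prime_divisors 1 = 0" "num_divisors 1 = 1"
    by (auto simp: num_divisors_def num_prime_divisors_def)
  thus ?thesis using True by simp
next
  case False
  define r where "r = num_prime_divisors u"
  define y where "y = ln (real u) / real r"
  have "real (num_divisors u) ^ 2 \<le> (3 ^ 8 * y ^ r) ^ 2"
    using num_divisors_le_log[of u] False assms by (intro power_mono) (auto simp: r_def y_def)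
  hence "real (num_divisors u) ^ 2 * 2 ^ r \<le> (3 ^ 8 * y ^ r) ^ 2 * 2 ^ r"
    by (rule mult_right_mono) simp
  also have "\<dots> = 3 ^ 16 * (sqrt 2 * y) ^ (2 * r)"
  proof -
    have "(sqrt 2 * y) ^ (2 * r) = 2 ^ r * (y\<^sup>2) ^ r"
      by (simp add: power_mult power_mult_distrib)
    moreover have "(3 ^ 8 * y ^ r)\<^sup>2 = 3 ^ 16 * (y\<^sup>2) ^ r"
      by (simp add: power_mult_distrib power_mult[symmetric] mult.commute)
    ultimately show ?thesis by simp
  qed
  finally show ?thesis by (simp add: r_def y_def)
qed

section \<open>Rhombic lattices\<close>

lemma norm_vec2_sq: "(norm (x :: real ^ 2))\<^sup>2 = (x $ 1)\<^sup>2 + (x $ 2)\<^sup>2"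
  by (simp add: norm_vec_def L2_set_def sum_2)

lemma lattice_of_basis2:
  fixes x y :: "real ^ 2"
  assumes nz: "x $ 1 * y $ 2 - y $ 1 * x $ 2 \<noteq> 0"
    and L: "L = {of_int i *\<^sub>R x + of_int j *\<^sub>R y | i j. True}"
  shows "full_rank_lattice L" "covolume L = \<bar>x $ 1 * y $ 2 - y $ 1 * x $ 2\<bar>"
proof -
  define A :: "real ^ 2 ^ 2" where "A = (\<chi> i j. if j = 1 then x $ i else y $ i)"
  have det: "det A = x $ 1 * y $ 2 - y $ 1 * x $ 2"
    by (simp add: A_def det_2)
  have Av: "A *v z = (z $ 1) *\<^sub>R x + (z $ 2) *\<^sub>R y" for z
    by (simp add: A_def vec_eq_iff forall_2 matrix_vector_mult_def sum_2 mult.commute)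
  have "L = (\<lambda>z. A *v z) ` int_vectors"
  proof (intro equalityI subsetI)
    fix v assume "v \<in> L"
    then obtain i j where v: "v = of_int i *\<^sub>R x + of_int j *\<^sub>R y" using L by auto
    define z :: "real ^ 2" where "z = vector [of_int i, of_int j]"
    have "v = A *v z" by (simp add: Av v z_def)
    moreover have "z \<in> int_vectors" by (simp add: z_def int_vectors_def forall_2)
    ultimately show "v \<in> (\<lambda>z. A *v z) ` int_vectors" by (rule image_eqI)
  next
    fix v assume "v \<in> (\<lambda>z. A *v z) ` int_vectors"
    then obtain z where "z \<in> int_vectors" and v: "v = A *v z" by auto
    hence "z $ 1 \<in> \<int>" "z $ 2 \<in> \<int>" by (auto simp: int_vectors_def)
    then obtain i j where "z $ 1 = of_int i" "z $ 2 = of_int j" by (auto elim!: Ints_cases)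
    thus "v \<in> L" by (auto simp: L v Av)
  qed
  hence "lattice_basis A L"
    using nz by (simp add: lattice_basis_def invertible_det_nz det)
  thus "full_rank_lattice L" "covolume L = \<bar>x $ 1 * y $ 2 - y $ 1 * x $ 2\<bar>"
    using covolume_eq[of A L] det by (auto simp: full_rank_lattice_def)
qed

lemma cramer2:
  fixes x y v :: "real ^ 2"
  assumes "x $ 1 * y $ 2 - y $ 1 * x $ 2 \<noteq> 0"
  obtains s t where "v = s *\<^sub>R x + t *\<^sub>R y"
proof
  define d where "d = x $ 1 * y $ 2 - y $ 1 * x $ 2"
  have "d \<noteq> 0" using assms by (simp add: d_def)
  show "v = ((v $ 1 * y $ 2 - y $ 1 * v $ 2) / d) *\<^sub>R x + ((x $ 1 * v $ 2 - v $ 1 * x $ 2) / d) *\<^sub>R y"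
    using \<open>d \<noteq> 0\<close> by (simp add: vec_eq_iff forall_2 field_simps) (simp add: d_def algebra_simps)
qed

lemma well_roundedI:
  fixes x y :: "real ^ 2"
  assumes nz: "x $ 1 * y $ 2 - y $ 1 * x $ 2 \<noteq> 0"
    and xy: "x \<in> L" "y \<in> L" "norm x = norm y"
    and min: "\<And>z. z \<in> L \<Longrightarrow> z \<noteq> 0 \<Longrightarrow> norm x \<le> norm z"
  shows "well_rounded L"
proof -
  have "x \<noteq> 0" using nz by auto
  hence "lattice_min L = norm x"
    unfolding lattice_min_def using xy min by (intro Least_equality) auto
  hence m: "x \<in> minimal_vectors L" "y \<in> minimal_vectors L"
    using xy by (auto simp: minimal_vectors_def)
  have "v \<in> span (minimal_vectors L)" for v
  proof -
    obtain s t where "v = s *\<^sub>R x + t *\<^sub>R y" using cramer2[OF nz] .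
    thus ?thesis using m by (simp add: span_add span_scale span_base)
  qed
  thus ?thesis by (auto simp: well_rounded_def)
qed

text \<open>This is the lattice spanned by \<open>(a, b)\<close> and \<open>(a, -b)\<close>: with
  integer coefficients \<open>i\<close> and \<open>j\<close> the coordinates are
  \<open>s = i + j\<close> and \<open>t = i - j\<close>, which are exactly the pairs of equal
  parity. Membership in this form makes the norm a diagonal quadratic form.\<close>

definition rhombic_lattice :: "nat \<Rightarrow> nat \<Rightarrow> (real ^ 2) set" where
  "rhombic_lattice a b = {x. \<exists>s t. even (s + t) \<and> x $ 1 = real a * of_int s \<and> x $ 2 = real b * of_int t}"

text \<open>The squared norm is \<open>a\<^sup>2 * s\<^sup>2 + b\<^sup>2 * t\<^sup>2\<close>. If
  \<open>s\<close> and \<open>t\<close> are both nonzero it is at least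
  \<open>a\<^sup>2 + b\<^sup>2\<close>. If one is 0, the other is even and nonzero, so it is at
  least four times \<open>a\<^sup>2\<close> or \<open>b\<^sup>2\<close>; the two ratio hypotheses
  make that large enough.\<close>

lemma rhombic_lattice_WR:
  assumes ab: "a > 0" "b > 0" "b\<^sup>2 \<le> 3 * a\<^sup>2" "a\<^sup>2 \<le> 3 * b\<^sup>2"
  shows "rhombic_lattice a b \<in> WR_Z2" "covolume (rhombic_lattice a b) = real (2 * (a * b))"
proof -
  define x y :: "real ^ 2" where "x = vector [real a, real b]" and "y = vector [real a, - real b]"
  have xy: "x $ 1 = a" "x $ 2 = b" "y $ 1 = a" "y $ 2 = - real b" by (simp_all add: x_def y_def)
  have det: "x $ 1 * y $ 2 - y $ 1 * x $ 2 = - real (2 * (a * b))" by (simp add: xy)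
  hence nz: "x $ 1 * y $ 2 - y $ 1 * x $ 2 \<noteq> 0" using ab by simp
  have L: "rhombic_lattice a b = {of_int i *\<^sub>R x + of_int j *\<^sub>R y | i j. True}"
  proof (intro equalityI subsetI)
    fix v assume "v \<in> rhombic_lattice a b"
    then obtain s t where st: "even (s + t)" "v $ 1 = real a * of_int s" "v $ 2 = real b * of_int t"
      by (auto simp: rhombic_lattice_def)
    from st(1) obtain i where i: "s + t = 2 * i" by (rule evenE)
    hence s: "s = 2 * i - t" by simp
    have "v = of_int i *\<^sub>R x + of_int (i - t) *\<^sub>R y"
      by (simp add: vec_eq_iff forall_2 xy st s algebra_simps)
    thus "v \<in> {of_int i *\<^sub>R x + of_int j *\<^sub>R y | i j. True}" by blast
  next
    fix v assume "v \<in> {of_int i *\<^sub>R x + of_int j *\<^sub>R y | i j. True}"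
    then obtain i j where v: "v = of_int i *\<^sub>R x + of_int j *\<^sub>R y" by blast
    show "v \<in> rhombic_lattice a b" unfolding rhombic_lattice_def v
      by (intro CollectI exI[of _ "i + j"] exI[of _ "i - j"]) (simp add: xy algebra_simps)
  qed
  have "rhombic_lattice a b \<subseteq> int_vectors"
    by (auto simp: rhombic_lattice_def int_vectors_def forall_2)
  moreover have "well_rounded (rhombic_lattice a b)"
  proof (rule well_roundedI[OF nz])
    show "x \<in> rhombic_lattice a b" unfolding L by (rule CollectI, rule exI[of _ 1], rule exI[of _ 0]) simp
    show "y \<in> rhombic_lattice a b" unfolding L by (rule CollectI, rule exI[of _ 0], rule exI[of _ 1]) simp
    have "(norm x)\<^sup>2 = (norm y)\<^sup>2" by (simp add: norm_vec2_sq xy)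
    thus "norm x = norm y" by simp
    fix z assume "z \<in> rhombic_lattice a b" "z \<noteq> 0"
    then obtain s t where st: "even (s + t)" "z $ 1 = real a * of_int s" "z $ 2 = real b * of_int t"
      by (auto simp: rhombic_lattice_def)
    have "s \<noteq> 0 \<or> t \<noteq> 0" using st \<open>z \<noteq> 0\<close> by (auto simp: vec_eq_iff forall_2)
    have sq: "4 \<le> (k::int)\<^sup>2" if "even k" "k \<noteq> 0" for k
    proof -
      have "2 \<le> \<bar>k\<bar>" using that by presburger
      from power_mono[OF this, of 2] show ?thesis by simp
    qed
    have sq1: "1 \<le> (k::int)\<^sup>2" if "k \<noteq> 0" for k
      using that by (simp add: int_one_le_iff_zero_less)
    \<comment> \<open>The factors 1 give both sides the same shape, so that termwise monotonicity
      applies.\<close>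
    have "int (a\<^sup>2) * 1 + int (b\<^sup>2) * 1 \<le> int (a\<^sup>2) * s\<^sup>2 + int (b\<^sup>2) * t\<^sup>2"
    proof (cases "s = 0 \<or> t = 0")
      case True
      then consider "s = 0" "t \<noteq> 0" "even t" | "t = 0" "s \<noteq> 0" "even s"
        using \<open>s \<noteq> 0 \<or> t \<noteq> 0\<close> st(1) by auto
      thus ?thesis
      proof cases
        case 1
        have "int (b\<^sup>2) * 4 \<le> int (b\<^sup>2) * t\<^sup>2" by (intro mult_left_mono sq 1) simp
        moreover have "int (a\<^sup>2) \<le> 3 * int (b\<^sup>2)" using ab(4) by linarith
        ultimately show ?thesis using 1 by simp
      next
        case 2
        have "int (a\<^sup>2) * 4 \<le> int (a\<^sup>2) * s\<^sup>2" by (intro mult_left_mono sq 2) simp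
        moreover have "int (b\<^sup>2) \<le> 3 * int (a\<^sup>2)" using ab(3) by linarith
        ultimately show ?thesis using 2 by simp
      qed
    next
      case False
      thus ?thesis by (intro add_mono mult_left_mono sq1) auto
    qed
    hence "real_of_int (int (a\<^sup>2) * 1 + int (b\<^sup>2) * 1) \<le> real_of_int (int (a\<^sup>2) * s\<^sup>2 + int (b\<^sup>2) * t\<^sup>2)"
      unfolding of_int_le_iff .
    hence "(norm x)\<^sup>2 \<le> (norm z)\<^sup>2"
      by (simp add: norm_vec2_sq xy st power_mult_distrib)
    thus "norm x \<le> norm z" by simp
  qed
  ultimately show "rhombic_lattice a b \<in> WR_Z2"
    using lattice_of_basis2(1)[OF nz L] by (simp add: WR_Z2_def)
  show "covolume (rhombic_lattice a b) = real (2 * (a * b))"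
    using lattice_of_basis2(2)[OF nz L] unfolding det by simp
qed

text \<open>The lattice meets the horizontal axis in the multiples of \<open>(2 a', 0)\<close>, and
  \<open>(2 a, 0)\<close> is such a point. Hence \<open>a\<close> can be recovered from the lattice,
  which makes the later map from divisors to lattices injective.\<close>

lemma rhombic_lattice_eq_dvd:
  assumes "rhombic_lattice a b \<subseteq> rhombic_lattice a' b'" "b' > 0"
  shows "a' dvd a"
proof -
  define z :: "real ^ 2" where "z = vector [2 * real a, 0]"
  have "z \<in> rhombic_lattice a b" unfolding rhombic_lattice_def z_def
    by (intro CollectI exI[of _ 2] exI[of _ 0]) simp
  hence "z \<in> rhombic_lattice a' b'" using assms by auto
  then obtain s t where st: "even (s + t)" "2 * real a = real a' * of_int s" "0 = real b' * of_int t"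
    by (auto simp: rhombic_lattice_def z_def)
  hence "even s" using assms(2) by simp
  then obtain i where "s = 2 * i" by (rule evenE)
  hence "real_of_int (int a) = real_of_int (int a' * i)" using st by simp
  hence "int a = int a' * i" unfolding of_int_eq_iff .
  hence "int a' dvd int a" by simp
  thus ?thesis by (simp only: int_dvd_int_iff)
qed

text \<open>These are the factorisations of \<open>c\<close> to which
  \<open>rhombic_lattice_WR\<close> applies: the ratio of the cofactors lies between
  \<open>1 / sqrt 3\<close> and \<open>sqrt 3\<close>.\<close>

definition balanced_divisors :: "nat \<Rightarrow> nat set" where
  "balanced_divisors c = {a. a dvd c \<and> (c div a)\<^sup>2 \<le> 3 * a\<^sup>2 \<and> a\<^sup>2 \<le> 3 * (c div a)\<^sup>2}"

lemma WR_count_double_ge: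
  assumes "c > 0"
  shows "card (balanced_divisors c) \<le> WR_count (2 * c)"
  unfolding WR_count_def
proof (rule card_inj_on_le[of "\<lambda>a. rhombic_lattice a (c div a)"])
  show "inj_on (\<lambda>a. rhombic_lattice a (c div a)) (balanced_divisors c)"
  proof (rule inj_onI)
    fix a a' assume "a \<in> balanced_divisors c"
      "a' \<in> balanced_divisors c"
      and eq: "rhombic_lattice a (c div a) = rhombic_lattice a' (c div a')"
    moreover have "c div d > 0" if "d \<in> balanced_divisors c" for d using that assms by (auto simp: balanced_divisors_def elim!: dvdE)
    ultimately show "a = a'" using eq rhombic_lattice_eq_dvd[of a "c div a" a' "c div a'"]
      rhombic_lattice_eq_dvd[of a' "c div a'" a "c div a"] by (intro dvd_antisym) auto
  qed
  show "(\<lambda>a. rhombic_lattice a (c div a)) ` balanced_divisors c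
      \<subseteq> {L \<in> WR_Z2. covolume L = real (2 * c)}"
  proof (rule image_subsetI)
    fix a assume a: "a \<in> balanced_divisors c"
    hence "a > 0" "c div a > 0" "a * (c div a) = c" using assms by (auto simp: balanced_divisors_def elim!: dvdE)
    moreover have "(c div a)\<^sup>2 \<le> 3 * a\<^sup>2" "a\<^sup>2 \<le> 3 * (c div a)\<^sup>2"
      using a by (simp_all add: balanced_divisors_def)
    ultimately show "rhombic_lattice a (c div a) \<in> {L \<in> WR_Z2. covolume L = real (2 * c)}"
      using rhombic_lattice_WR[of a "c div a"] by auto
  qed
qed (rule finite_WR_Z2_covolume)

lemma WR_dets_of_count: "WR_count u > 0 \<Longrightarrow> real u \<in> WR_dets"
  unfolding WR_count_def WR_dets_def card_gt_0_iff by force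

text \<open>The square lattice itself supplies the first term of the final sequence.\<close>

lemma one_in_WR_dets: "1 \<in> WR_dets"
proof -
  define x y :: "real ^ 2" where "x = vector [1, 0]" and "y = vector [0, 1]"
  have xy: "x $ 1 = 1" "x $ 2 = 0" "y $ 1 = 0" "y $ 2 = 1" by (simp_all add: x_def y_def)
  have det: "x $ 1 * y $ 2 - y $ 1 * x $ 2 = 1" by (simp add: xy)
  hence nz: "x $ 1 * y $ 2 - y $ 1 * x $ 2 \<noteq> 0" by simp
  have L: "int_vectors = {of_int i *\<^sub>R x + of_int j *\<^sub>R y | i j. True}"
  proof (intro equalityI subsetI)
    fix v :: "real ^ 2" assume "v \<in> int_vectors"
    hence "v $ 1 \<in> \<int>" "v $ 2 \<in> \<int>" by (auto simp: int_vectors_def)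
    then obtain i j where "v $ 1 = of_int i" "v $ 2 = of_int j" by (auto elim!: Ints_cases)
    hence "v = of_int i *\<^sub>R x + of_int j *\<^sub>R y" by (simp add: vec_eq_iff forall_2 xy)
    thus "v \<in> {of_int i *\<^sub>R x + of_int j *\<^sub>R y | i j. True}" by blast
  next
    fix v assume "v \<in> {of_int i *\<^sub>R x + of_int j *\<^sub>R y | i j. True}"
    thus "v \<in> int_vectors" by (auto simp: int_vectors_def forall_2 xy)
  qed
  have "well_rounded (int_vectors :: (real ^ 2) set)"
  proof (rule well_roundedI[OF nz])
    show "x \<in> int_vectors" "y \<in> int_vectors" by (auto simp: int_vectors_def forall_2 xy)
    have "(norm x)\<^sup>2 = (norm y)\<^sup>2" by (simp add: norm_vec2_sq xy)
    thus "norm x = norm y" by simp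
    fix z :: "real ^ 2" assume z: "z \<in> int_vectors" "z \<noteq> 0"
    then obtain i where i: "z $ i \<noteq> 0" by (auto simp: vec_eq_iff)
    have "1 \<le> \<bar>z $ i\<bar>" using z i by (intro Ints_nonzero_abs_ge1) (auto simp: int_vectors_def)
    also have "\<dots> \<le> norm z" by (rule component_le_norm_cart)
    finally show "norm x \<le> norm z" using norm_vec2_sq[of x] norm_ge_zero[of x] by (auto simp: xy power2_eq_1_iff)
  qed
  hence "int_vectors \<in> WR_Z2"
    using lattice_of_basis2(1)[OF nz L] by (simp add: WR_Z2_def)
  moreover have "covolume (int_vectors :: (real ^ 2) set) = 1"
    using lattice_of_basis2(2)[OF nz L] det by simp
  ultimately show ?thesis unfolding WR_dets_def by (metis image_eqI)
qed

section \<open>Parametrisation of well-rounded lattices\<close>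

text \<open>A least element of a set of reals has to be shown to exist. Squared norms of integer
  vectors are natural numbers, so a shortest nonzero vector exists.\<close>

lemma lattice_min_attained:
  assumes L: "full_rank_lattice L" "L \<subseteq> (int_vectors :: (real ^ 2) set)"
  shows "lattice_min L > 0" "\<And>z. z \<in> L \<Longrightarrow> z \<noteq> 0 \<Longrightarrow> lattice_min L \<le> norm z"
proof -
  define f where "f = (\<lambda>z :: real ^ 2. nat \<lfloor>(norm z)\<^sup>2\<rfloor>)"
  have f: "(norm z)\<^sup>2 = real (f z)" if "z \<in> L" for z
  proof -
    have "z $ 1 \<in> \<int>" "z $ 2 \<in> \<int>" using that L by (auto simp: int_vectors_def)
    hence "(norm z)\<^sup>2 \<in> \<int>" unfolding norm_vec2_sq by (intro Ints_add Ints_power)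
    then obtain k where k: "(norm z)\<^sup>2 = of_int k" by (elim Ints_cases)
    hence "k \<ge> 0" by (metis of_int_0_le_iff zero_le_power2)
    thus ?thesis by (simp add: f_def k)
  qed
  have "\<exists>z. z \<in> L \<and> z \<noteq> 0"
  proof -
    have "(axis 1 1 :: real ^ 2) \<in> int_vectors" by (auto simp: int_vectors_def axis_def)
    from scaled_int_vectors_subset[OF L this]
    have "covolume L *\<^sub>R axis 1 1 \<in> L" .
    moreover have "covolume L *\<^sub>R (axis 1 1 :: real ^ 2) \<noteq> 0"
      using covolume_pos[OF L(1)] by (auto simp: axis_eq_0_iff)
    ultimately show ?thesis by blast
  qed
  then obtain z0 where z0: "z0 \<in> L" "z0 \<noteq> 0" and min: "\<And>z. z \<in> L \<Longrightarrow> z \<noteq> 0 \<Longrightarrow> f z0 \<le> f z"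
    using ex_has_least_nat[of "\<lambda>z. z \<in> L \<and> z \<noteq> 0" _ f] by blast
  have min': "norm z0 \<le> norm z" if "z \<in> L" "z \<noteq> 0" for z
  proof -
    have "(norm z0)\<^sup>2 \<le> (norm z)\<^sup>2" using min[OF that] that z0 by (simp add: f)
    thus ?thesis by simp
  qed
  have "lattice_min L = norm z0"
    unfolding lattice_min_def using z0 min' by (intro Least_equality) auto
  thus "lattice_min L > 0" "\<And>z. z \<in> L \<Longrightarrow> z \<noteq> 0 \<Longrightarrow> lattice_min L \<le> norm z"
    using z0 min' by auto
qed

lemma lattice_int_scale:
  fixes L :: "(real ^ 'n) set"
  assumes "full_rank_lattice L" "x \<in> L"
  shows "of_int i *\<^sub>R x \<in> L"
proof -
  obtain A :: "real ^ 'n ^ 'n" where A: "L = (\<lambda>z. A *v z) ` int_vectors"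
    using assms(1) unfolding full_rank_lattice_def lattice_basis_def by blast
  then obtain z where z: "z \<in> int_vectors" "x = A *v z" using assms(2) by blast
  have "of_int i *\<^sub>R x = A *v (of_int i *\<^sub>R z)" by (simp add: z matrix_vector_mult_scaleR)
  moreover have "of_int i *\<^sub>R z \<in> int_vectors" using z(1) by (auto simp: int_vectors_def)
  ultimately show ?thesis unfolding A by (rule image_eqI)
qed

text \<open>If all minimal vectors were parallel to one of them, \<open>x\<close>, they would lie in
  the subspace where the determinant with \<open>x\<close> vanishes, which is not the whole
  plane.\<close>

lemma well_rounded_independent:
  fixes L :: "(real ^ 2) set"
  assumes "well_rounded L"
  obtains x y where "x \<in> minimal_vectors L" "y \<in> minimal_vectors L" "x $ 1 * y $ 2 - y $ 1 * x $ 2 \<noteq> 0"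
proof -
  have span: "span (minimal_vectors L) = UNIV" using assms by (simp add: well_rounded_def)
  have "\<exists>x \<in> minimal_vectors L. x \<noteq> 0"
  proof (rule ccontr)
    assume "\<not> ?thesis"
    hence "minimal_vectors L \<subseteq> {0}" by auto
    hence "span (minimal_vectors L) \<subseteq> {0}" using span_mono by (metis span_0 span_empty span_insert_0)
    with span have "axis 1 1 = (0 :: real ^ 2)" by auto
    thus False by (simp add: axis_eq_0_iff)
  qed
  then obtain x where x: "x \<in> minimal_vectors L" "x \<noteq> 0" by auto
  have "\<exists>y \<in> minimal_vectors L. x $ 1 * y $ 2 - y $ 1 * x $ 2 \<noteq> 0"
  proof (rule ccontr)
    assume "\<not> ?thesis"
    hence "minimal_vectors L \<subseteq> {y. x $ 1 * y $ 2 - y $ 1 * x $ 2 = 0}" by auto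
    moreover have "subspace {y :: real ^ 2. x $ 1 * y $ 2 - y $ 1 * x $ 2 = 0}"
    proof (rule subspaceI; clarsimp)
      fix y z :: "real ^ 2"
      assume "x $ 1 * y $ 2 = y $ 1 * x $ 2" "x $ 1 * z $ 2 = z $ 1 * x $ 2"
      thus "x $ 1 * (y $ 2 + z $ 2) = (y $ 1 + z $ 1) * x $ 2" by (simp add: algebra_simps)
    qed
    ultimately have "span (minimal_vectors L) \<subseteq> {y. x $ 1 * y $ 2 - y $ 1 * x $ 2 = 0}"
      by (rule span_minimal)
    \<comment> \<open>The vector perpendicular to \<open>x\<close> has determinant with
      \<open>x\<close> equal to the squared norm of \<open>x\<close>, so it lies outside the
      line.\<close>
    hence "(vector [- (x $ 2), x $ 1] :: real ^ 2) \<in> {y. x $ 1 * y $ 2 - y $ 1 * x $ 2 = 0}"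
      unfolding span by (rule subsetD[OF _ UNIV_I])
    hence "x $ 1 * x $ 1 + x $ 2 * x $ 2 = 0" by simp
    hence "(norm x)\<^sup>2 = 0" unfolding norm_vec2_sq by (simp only: power2_eq_square)
    thus False using x by simp
  qed
  thus ?thesis using that x by auto
qed

text \<open>With inner product \<open>e\<close>, the squared norm of the combination is
  \<open>s\<^sup>2 * N + t\<^sup>2 * N + 2 * (s * t * e)\<close>. Independence makes Cauchy-Schwarz
  strict, so \<open>\<bar>e\<bar> < N\<close> and the sum is below
  \<open>N/4 + N/4 + N/2\<close>.\<close>

lemma nearest_combination_shorter:
  fixes x1 x2 y1 y2 s t N :: real
  assumes N: "x1\<^sup>2 + x2\<^sup>2 = N" "y1\<^sup>2 + y2\<^sup>2 = N" "x1 * y2 - y1 * x2 \<noteq> 0" "\<bar>s\<bar> \<le> 1 / 2" "\<bar>t\<bar> \<le> 1 / 2"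
  shows "(s * x1 + t * y1)\<^sup>2 + (s * x2 + t * y2)\<^sup>2 < N"
proof -
  define e where "e = x1 * y1 + x2 * y2"
  \<comment> \<open>Lagrange's identity.\<close>
  have "e\<^sup>2 + (x1 * y2 - y1 * x2)\<^sup>2 = (x1\<^sup>2 + x2\<^sup>2) * (y1\<^sup>2 + y2\<^sup>2)"
    by (simp add: e_def power2_eq_square algebra_simps)
  hence "e\<^sup>2 + (x1 * y2 - y1 * x2)\<^sup>2 = N\<^sup>2" by (simp only: N power2_eq_square[of N])
  moreover have "(x1 * y2 - y1 * x2)\<^sup>2 > 0" using N(3) by simp
  ultimately have "e\<^sup>2 < N\<^sup>2" by linarith
  moreover have "N \<ge> 0" using N(1) by (metis sum_power2_ge_zero)
  ultimately have e: "\<bar>e\<bar> < N" by (metis abs_of_nonneg power2_abs power_less_imp_less_base)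
  have sq: "s\<^sup>2 \<le> 1 / 4" "t\<^sup>2 \<le> 1 / 4"
    using abs_le_square_iff[of s "1/2"] abs_le_square_iff[of t "1/2"] N(4,5) by (simp_all add: power2_eq_square)
  have st: "\<bar>s * t\<bar> \<le> 1 / 4"
    using mult_mono[OF N(4,5)] by (simp add: abs_mult)
  have "(s * x1 + t * y1)\<^sup>2 + (s * x2 + t * y2)\<^sup>2 = s\<^sup>2 * (x1\<^sup>2 + x2\<^sup>2) + t\<^sup>2 * (y1\<^sup>2 + y2\<^sup>2) + 2 * (s * t * e)"
    by (simp add: e_def power2_eq_square algebra_simps)
  also have "\<dots> = s\<^sup>2 * N + t\<^sup>2 * N + 2 * (s * t * e)" by (simp only: N)
  also have "\<dots> \<le> 1 / 4 * N + 1 / 4 * N + 2 * (1 / 4 * \<bar>e\<bar>)"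
  proof (intro add_mono mult_left_mono)
    show "s\<^sup>2 * N \<le> 1 / 4 * N" "t\<^sup>2 * N \<le> 1 / 4 * N" using mult_right_mono[OF sq(1) \<open>N \<ge> 0\<close>] mult_right_mono[OF sq(2) \<open>N \<ge> 0\<close>] .
    have "s * t * e \<le> \<bar>s * t\<bar> * \<bar>e\<bar>" by (metis abs_ge_self abs_mult)
    also have "\<dots> \<le> 1 / 4 * \<bar>e\<bar>" using st by (rule mult_right_mono) simp
    finally show "s * t * e \<le> 1 / 4 * \<bar>e\<bar>" .
  qed simp
  also have "\<dots> < N" using e by simp
  finally show ?thesis .
qed

text \<open>Rounding the real coordinates of a lattice vector with respect to two independent
  minimal vectors leaves a lattice vector shorter than the minimum, hence 0.\<close>

lemma WR_Z2_minimal_basis: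
  assumes "L \<in> WR_Z2"
  obtains x y where "norm x = norm y" "x $ 1 * y $ 2 - y $ 1 * x $ 2 \<noteq> 0"
    "L = {of_int i *\<^sub>R x + of_int j *\<^sub>R y | i j. True}"
proof -
  have L: "full_rank_lattice L" "L \<subseteq> int_vectors" "well_rounded L"
    using assms by (auto simp: WR_Z2_def)
  obtain x y where xy: "x \<in> minimal_vectors L" "y \<in> minimal_vectors L"
    and nz: "x $ 1 * y $ 2 - y $ 1 * x $ 2 \<noteq> 0"
    using well_rounded_independent[OF L(3)] .
  have xyL: "x \<in> L" "y \<in> L" and nxy: "norm x = lattice_min L" "norm y = lattice_min L"
    using xy by (auto simp: minimal_vectors_def)
  note closed = lattice_closed[OF L(1)] lattice_int_scale[OF L(1)]
  have "L = {of_int i *\<^sub>R x + of_int j *\<^sub>R y | i j. True}"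
  proof (intro equalityI subsetI)
    fix v assume v: "v \<in> L"
    obtain s t where st: "v = s *\<^sub>R x + t *\<^sub>R y" using cramer2[OF nz] .
    define w where "w = v - (of_int (round s) *\<^sub>R x + of_int (round t) *\<^sub>R y)"
    define s' t' where "s' = s - of_int (round s)" and "t' = t - of_int (round t)"
    have w: "w = s' *\<^sub>R x + t' *\<^sub>R y" 
      unfolding w_def st s'_def t'_def by (simp add: scaleR_diff_left)
    have st': "\<bar>s'\<bar> \<le> 1 / 2" "\<bar>t'\<bar> \<le> 1 / 2"
      using of_int_round_abs_le[of s] of_int_round_abs_le[of t] unfolding s'_def t'_def by linarith+
    have "(norm w)\<^sup>2 < (lattice_min L)\<^sup>2"
      unfolding norm_vec2_sq w vector_add_component vector_scaleR_component real_scaleR_def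
    proof (rule nearest_combination_shorter[OF _ _ nz st'])
      show "(x $ 1)\<^sup>2 + (x $ 2)\<^sup>2 = (lattice_min L)\<^sup>2" "(y $ 1)\<^sup>2 + (y $ 2)\<^sup>2 = (lattice_min L)\<^sup>2"
        unfolding norm_vec2_sq[symmetric] nxy by (rule refl)+
    qed
    hence "norm w < lattice_min L"
      by (rule power_less_imp_less_base) (use lattice_min_attained(1)[OF L(1,2)] in auto)
    moreover have "w \<in> L" unfolding w_def by (intro closed v xyL)
    ultimately have "w = 0"
      using lattice_min_attained(2)[OF L(1,2), of w] by (meson not_le)
    hence "v = of_int (round s) *\<^sub>R x + of_int (round t) *\<^sub>R y" by (simp add: w_def)
    thus "v \<in> {of_int i *\<^sub>R x + of_int j *\<^sub>R y | i j. True}" by blast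
  next
    fix v assume "v \<in> {of_int i *\<^sub>R x + of_int j *\<^sub>R y | i j. True}"
    then obtain i j where v: "v = of_int i *\<^sub>R x + of_int j *\<^sub>R y" by blast
    show "v \<in> L" unfolding v by (intro closed xyL)
  qed
  with that[OF _ nz] nxy show ?thesis by simp
qed

text \<open>If \<open>x + y = P\<close> and \<open>x - y = Q\<close>, then the combinations of
  \<open>x\<close> and \<open>y\<close> are the vectors \<open>(i P + j Q) / 2\<close> with
  \<open>i\<close>, \<open>j\<close> of equal parity. Here \<open>P = a (m, n)\<close> and
  \<open>Q = b (-n, m)\<close>; the coordinates are doubled to keep the right-hand sides
  integral.\<close>

definition params_lattice :: "nat \<times> nat \<times> int \<times> int \<Rightarrow> (real ^ 2) set" where
  "params_lattice = (\<lambda>(a, b, m, n). {x. \<exists>i j :: int. even (i + j) \<and>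
     2 * x $ 1 = of_int (i * int a * m - j * int b * n) \<and>
     2 * x $ 2 = of_int (i * int a * n + j * int b * m)})"

text \<open>Take out the gcd of the first vector to get a primitive \<open>(m, n)\<close>. A Bezout
  relation \<open>u * m + v * n = 1\<close> then exhibits the orthogonal vector as an integer
  multiple of \<open>(-n, m)\<close>.\<close>

lemma int_orthogonal_factor:
  fixes P1 P2 Q1 Q2 :: int
  assumes P: "P1 \<noteq> 0 \<or> P2 \<noteq> 0" and orth: "P1 * Q1 + P2 * Q2 = 0"
  obtains g k m n where "g > 0" "coprime m n" "P1 = g * m" "P2 = g * n" "Q1 = - k * n" "Q2 = k * m"
proof -
  define g where "g = gcd P1 P2"
  define m n where "m = P1 div g" and "n = P2 div g"
  have g: "g > 0" using P by (simp add: g_def)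
  have mn: "P1 = g * m" "P2 = g * n" by (simp_all add: m_def n_def g_def)
  have c: "coprime m n" unfolding m_def n_def g_def using P by (rule div_gcd_coprime)
  obtain u v where uv: "u * m + v * n = 1"
    using bezout_int[of m n] c by (auto simp: coprime_iff_gcd_eq_1)
  define k where "k = u * Q2 - v * Q1"
  have "g * (m * Q1 + n * Q2) = 0" using orth by (simp add: mn algebra_simps)
  hence o: "n * Q2 = - (m * Q1)" using g by simp
  have "k * m = (u * m) * Q2 - v * (m * Q1)" by (simp add: k_def algebra_simps)
  also have "\<dots> = (u * m) * Q2 + v * (n * Q2)" by (simp add: o)
  also have "\<dots> = (u * m + v * n) * Q2" by (simp add: algebra_simps)
  finally have k2: "Q2 = k * m" by (simp add: uv)
  have "- k * n = - u * (n * Q2) + (v * n) * Q1" by (simp add: k_def algebra_simps)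
  also have "\<dots> = - u * (- (m * Q1)) + (v * n) * Q1" by (simp only: o)
  also have "\<dots> = (u * m + v * n) * Q1" by (simp add: algebra_simps)
  finally have k1: "Q1 = - k * n" by (simp add: uv)
  show ?thesis using that[OF g c mn k1 k2] .
qed

text \<open>For basis vectors of equal norm, \<open>x + y\<close> and \<open>x - y\<close> are
  orthogonal, hence factor through one primitive vector. Their determinant is -2 times that of
  \<open>x\<close> and \<open>y\<close>, which yields
  \<open>g * \<bar>k\<bar> * (m\<^sup>2 + n\<^sup>2) = 2 * u\<close>.\<close>

lemma WR_Z2_params:
  assumes L: "L \<in> WR_Z2" and cov: "covolume L = real u"
  shows "\<exists>z \<in> wr_params u. L = params_lattice z"
proof -
  obtain x y where nxy: "norm x = norm y" and nz: "x $ 1 * y $ 2 - y $ 1 * x $ 2 \<noteq> 0"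
    and Leq: "L = {of_int i *\<^sub>R x + of_int j *\<^sub>R y | i j. True}"
    using WR_Z2_minimal_basis[OF L] .
  have "x \<in> L" unfolding Leq by (rule CollectI, rule exI[of _ 1], rule exI[of _ 0]) simp
  moreover have "y \<in> L" unfolding Leq by (rule CollectI, rule exI[of _ 0], rule exI[of _ 1]) simp
  ultimately have "x $ 1 \<in> \<int>" "x $ 2 \<in> \<int>" "y $ 1 \<in> \<int>" "y $ 2 \<in> \<int>"
    using L by (auto simp: WR_Z2_def int_vectors_def)
  then obtain X1 X2 Y1 Y2 where X: "x $ 1 = of_int X1" "x $ 2 = of_int X2" "y $ 1 = of_int Y1" "y $ 2 = of_int Y2"
    by (auto elim!: Ints_cases)
  have "(norm x)\<^sup>2 = (norm y)\<^sup>2" using nxy by simp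
  hence "real_of_int (X1\<^sup>2 + X2\<^sup>2) = real_of_int (Y1\<^sup>2 + Y2\<^sup>2)" by (simp add: norm_vec2_sq X)
  hence sq: "X1\<^sup>2 + X2\<^sup>2 = Y1\<^sup>2 + Y2\<^sup>2" unfolding of_int_eq_iff .
  have "real u = \<bar>x $ 1 * y $ 2 - y $ 1 * x $ 2\<bar>"
    using lattice_of_basis2(2)[OF nz Leq] cov by simp
  hence "real_of_int (int u) = real_of_int \<bar>X1 * Y2 - Y1 * X2\<bar>" by (simp add: X)
  hence det: "int u = \<bar>X1 * Y2 - Y1 * X2\<bar>" unfolding of_int_eq_iff .
  have u: "u > 0" using L cov covolume_pos[of L] by (simp add: WR_Z2_def)
  have orth: "(X1 + Y1) * (X1 - Y1) + (X2 + Y2) * (X2 - Y2) = 0"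
    using sq by (simp add: power2_eq_square algebra_simps)
  have det2: "(X1 + Y1) * (X2 - Y2) - (X2 + Y2) * (X1 - Y1) = - 2 * (X1 * Y2 - Y1 * X2)"
    by (simp add: algebra_simps)
  have "X1 + Y1 \<noteq> 0 \<or> X2 + Y2 \<noteq> 0"
  proof (rule ccontr)
    assume "\<not> ?thesis"
    hence "X1 * Y2 - Y1 * X2 = 0" using det2 by simp
    thus False using det u by simp
  qed
  from this orth obtain g k m n where g: "g > 0" and c: "coprime m n"
    and PQ: "X1 + Y1 = g * m" "X2 + Y2 = g * n" "X1 - Y1 = - k * n" "X2 - Y2 = k * m"
    by (rule int_orthogonal_factor)
  have "- 2 * (X1 * Y2 - Y1 * X2) = g * k * (m\<^sup>2 + n\<^sup>2)"
    unfolding det2[symmetric] PQ by (simp add: power2_eq_square algebra_simps)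
  hence "\<bar>- 2\<bar> * \<bar>X1 * Y2 - Y1 * X2\<bar> = \<bar>g * k * (m\<^sup>2 + n\<^sup>2)\<bar>" by (simp only: abs_mult[symmetric])
  hence eq: "2 * int u = g * \<bar>k\<bar> * (m\<^sup>2 + n\<^sup>2)" unfolding det using g by (simp add: abs_mult)
  hence k: "k \<noteq> 0" using u by auto
  define a b where "a = nat g" and "b = nat \<bar>k\<bar>"
  have ab: "int a = g" "int b = \<bar>k\<bar>" "a > 0" "b > 0" using g k by (simp_all add: a_def b_def)
  have "(a, b, m, n) \<in> wr_params u" using ab c eq by (simp add: wr_params_def)
  moreover have "L = params_lattice (a, b, m, n)"
  proof (intro equalityI subsetI)
    fix v assume "v \<in> L"
    then obtain i j where v: "v = of_int i *\<^sub>R x + of_int j *\<^sub>R y" unfolding Leq by blast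
    \<comment> \<open>The parameter \<open>b\<close> must be positive, so the sign of
      \<open>k\<close> is moved into the coefficient; this does not change its parity.\<close>
    define j' where "j' = sgn k * (i - j)"
    have j': "j' * \<bar>k\<bar> = (i - j) * k" by (simp add: j'_def abs_sgn[of k] sgn_if)
    have 1: "2 * v $ 1 = of_int ((i + j) * (X1 + Y1) + (i - j) * (X1 - Y1))"
      and 2: "2 * v $ 2 = of_int ((i + j) * (X2 + Y2) + (i - j) * (X2 - Y2))"
      by (simp_all add: v X algebra_simps)
    have "(i + j) * (X1 + Y1) + (i - j) * (X1 - Y1) = (i + j) * int a * m - j' * int b * n"
      "(i + j) * (X2 + Y2) + (i - j) * (X2 - Y2) = (i + j) * int a * n + j' * int b * m"
      unfolding PQ ab j' by (simp_all add: algebra_simps)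
    moreover have "even ((i + j) + j')" using k by (auto simp: j'_def sgn_if)
    ultimately show "v \<in> params_lattice (a, b, m, n)"
      unfolding params_lattice_def using 1 2 by (simp only: case_prod_conv mem_Collect_eq) blast
  next
    fix v assume "v \<in> params_lattice (a, b, m, n)"
    then obtain i j where ij: "even (i + j)" and v1: "2 * v $ 1 = of_int (i * int a * m - j * int b * n)"
      and v2: "2 * v $ 2 = of_int (i * int a * n + j * int b * m)"
      unfolding params_lattice_def by (simp only: case_prod_conv mem_Collect_eq) blast
    define j' where "j' = sgn k * j"
    have j': "j * \<bar>k\<bar> = j' * k" by (simp add: j'_def abs_sgn[of k] mult.commute)
    have "even (i + j')" using ij k by (auto simp: j'_def sgn_if)
    then obtain s where s: "i + j' = 2 * s" by (rule evenE)
    hence j's: "j' = 2 * s - i" by simp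
    have h: "i * int a * m - j * int b * n = i * (X1 + Y1) + j' * (X1 - Y1)"
      "i * int a * n + j * int b * m = i * (X2 + Y2) + j' * (X2 - Y2)"
      unfolding PQ ab j' by (simp_all add: algebra_simps)
    have "2 * v $ 1 = 2 * (of_int s * of_int X1 + of_int (i - s) * of_int Y1)"
      "2 * v $ 2 = 2 * (of_int s * of_int X2 + of_int (i - s) * of_int Y2)"
      unfolding v1 v2 h j's by (simp_all add: algebra_simps)
    hence "v = of_int s *\<^sub>R x + of_int (i - s) *\<^sub>R y"
      by (simp add: vec_eq_iff forall_2 X)
    thus "v \<in> L" unfolding Leq by blast
  qed
  ultimately show ?thesis by blast
qed

lemma WR_count_le_card_wr_params:
  assumes "u > 0"
  shows "WR_count u \<le> card (wr_params u)"
proof -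
  have "{L \<in> WR_Z2. covolume L = real u} \<subseteq> params_lattice ` wr_params u"
    using WR_Z2_params by blast
  from order_trans[OF card_mono[OF finite_imageI[OF wr_params_bound(1)[OF assms]] this]
      card_image_le[OF wr_params_bound(1)[OF assms]]]
  show ?thesis unfolding WR_count_def .
qed

section \<open>The average number of lattices\<close>

text \<open>The disc lies in a square with \<open>2 * k + 1\<close> integer points per side, and
  \<open>Y \<ge> 1\<close> bounds this by \<open>3 * sqrt Y\<close>.\<close>

lemma card_lattice_points_disc_le:
  fixes Y :: real
  assumes "Y \<ge> 1"
  shows "finite {(m :: int, n :: int). of_int (m\<^sup>2 + n\<^sup>2) \<le> Y}"
    and "real (card {(m :: int, n :: int). of_int (m\<^sup>2 + n\<^sup>2) \<le> Y}) \<le> 9 * Y"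
proof -
  define k where "k = \<lfloor>sqrt Y\<rfloor>"
  have k: "k \<ge> 0" "of_int k \<le> sqrt Y" using assms by (simp_all add: k_def)
  have bd: "m \<in> {-k..k}" if "of_int (m\<^sup>2) \<le> Y" for m :: int
  proof -
    have "(real_of_int m)\<^sup>2 \<le> Y" using that by simp
    hence "\<bar>real_of_int m\<bar> \<le> sqrt Y" by (rule real_le_rsqrt[OF _, of "\<bar>real_of_int m\<bar>", simplified power2_abs])
    hence "\<bar>m\<bar> \<le> k" unfolding k_def by (simp add: le_floor_iff)
    thus ?thesis by auto
  qed
  have sub: "{(m :: int, n :: int). of_int (m\<^sup>2 + n\<^sup>2) \<le> Y} \<subseteq> {-k..k} \<times> {-k..k}"
  proof clarify
    fix m n :: int assume mn: "of_int (m\<^sup>2 + n\<^sup>2) \<le> Y"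
    have "real_of_int (m\<^sup>2) \<le> of_int (m\<^sup>2 + n\<^sup>2)" "real_of_int (n\<^sup>2) \<le> of_int (m\<^sup>2 + n\<^sup>2)"
      unfolding of_int_le_iff by simp_all
    with mn show "m \<in> {-k..k} \<and> n \<in> {-k..k}" using bd[of m] bd[of n] by linarith
  qed
  thus "finite {(m :: int, n :: int). of_int (m\<^sup>2 + n\<^sup>2) \<le> Y}" by (rule finite_subset) simp
  have "card {(m :: int, n :: int). of_int (m\<^sup>2 + n\<^sup>2) \<le> Y} \<le> card ({-k..k} \<times> {-k..k})"
    using sub by (intro card_mono) auto
  hence "real (card {(m :: int, n :: int). of_int (m\<^sup>2 + n\<^sup>2) \<le> Y}) \<le> real (card ({-k..k} \<times> {-k..k}))"
    by (rule of_nat_mono)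
  also have "\<dots> = (2 * of_int k + 1)\<^sup>2"
    using k(1) by (simp add: card_cartesian_product power2_eq_square)
  also have "\<dots> \<le> (3 * sqrt Y)\<^sup>2"
  proof (rule power_mono)
    have "1 \<le> sqrt Y" using assms by simp
    thus "2 * of_int k + 1 \<le> 3 * sqrt Y" using k(2) by linarith
  qed (use k in auto)
  also have "\<dots> = 9 * Y" using assms by (simp add: power_mult_distrib)
  finally show "real (card {(m :: int, n :: int). of_int (m\<^sup>2 + n\<^sup>2) \<le> Y}) \<le> 9 * Y" .
qed

text \<open>The parameter sets of different \<open>u\<close> are disjoint, so it suffices to count
  all tuples with \<open>a b (m\<^sup>2 + n\<^sup>2) \<le> 2 M\<close>. For fixed \<open>a\<close>,
  \<open>b\<close> the disc bound gives \<open>9 * 2 M / (a b)\<close>, and summing over both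
  produces the square of the harmonic sum.\<close>

lemma sum_WR_count_le:
  "real (\<Sum>u\<in>{1..M}. WR_count u) \<le> 18 * real M * harm (2 * M) ^ 2"
proof -
  define I where "I = {1..2 * M}"
  \<comment> \<open>Excluding the origin makes the set empty once \<open>a * b > 2 * M\<close>, so
    the disc bound is applied only where its radius condition \<open>Y \<ge> 1\<close>
    holds.\<close>
  define R where "R = (\<lambda>(a, b). {(m :: int, n :: int). int a * int b * (m\<^sup>2 + n\<^sup>2) \<le> 2 * int M \<and> m\<^sup>2 + n\<^sup>2 > 0})"
  have R: "finite (R (a, b)) \<and> real (card (R (a, b))) \<le> 18 * real M * (inverse (real a) * inverse (real b))"
    if "a \<in> I" "b \<in> I" for a b
  proof -
    define Y where "Y = 2 * real M / (real a * real b)"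
    have ab: "a > 0" "b > 0" using that by (auto simp: I_def)
    have sub: "R (a, b) \<subseteq> {(m, n). of_int (m\<^sup>2 + n\<^sup>2) \<le> Y}" and one: "R (a, b) \<noteq> {} \<Longrightarrow> Y \<ge> 1"
    proof -
      have *: "of_int (m\<^sup>2 + n\<^sup>2) \<le> Y" if "int a * int b * (m\<^sup>2 + n\<^sup>2) \<le> 2 * int M" for m n
      proof -
        have "real_of_int (int a * int b * (m\<^sup>2 + n\<^sup>2)) \<le> real_of_int (2 * int M)"
          using that unfolding of_int_le_iff .
        thus ?thesis using ab by (simp add: Y_def field_simps)
      qed
      thus "R (a, b) \<subseteq> {(m, n). of_int (m\<^sup>2 + n\<^sup>2) \<le> Y}" by (auto simp: R_def)
      assume "R (a, b) \<noteq> {}"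
      then obtain m n where mn: "int a * int b * (m\<^sup>2 + n\<^sup>2) \<le> 2 * int M" "m\<^sup>2 + n\<^sup>2 > 0"
        unfolding R_def by blast
      have "1 \<le> m\<^sup>2 + n\<^sup>2" using mn(2) by simp
      hence "real_of_int 1 \<le> of_int (m\<^sup>2 + n\<^sup>2)" unfolding of_int_le_iff .
      with *[OF mn(1)] show "Y \<ge> 1" by simp
    qed
    show ?thesis
    proof (cases "R (a, b) = {}")
      case False
      note pts = card_lattice_points_disc_le[OF one[OF False]]
      have "real (card (R (a, b))) \<le> real (card {(m :: int, n :: int). of_int (m\<^sup>2 + n\<^sup>2) \<le> Y})"
        using card_mono[OF pts(1) sub] by (rule of_nat_mono)
      also have "\<dots> \<le> 9 * Y" by (rule pts(2))
      also have "\<dots> = 18 * real M * (inverse (real a) * inverse (real b))"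
        by (simp add: Y_def field_simps)
      finally show ?thesis using finite_subset[OF sub pts(1)] by simp
    qed simp
  qed
  have fI: "finite I" by (simp add: I_def)
  have fS: "finite (SIGMA x:I \<times> I. R x)"
    using R fI by (intro finite_SigmaI) auto
  have sub: "(\<Union>u\<in>{1..M}. wr_params u) \<subseteq> (\<lambda>((a, b), m, n). (a, b, m, n)) ` (SIGMA x:I \<times> I. R x)"
  proof
    fix z assume "z \<in> (\<Union>u\<in>{1..M}. wr_params u)"
    then obtain u a b m n where z: "z = (a, b, m, n)" and ab: "a > 0" "b > 0" and u: "u \<ge> 1" "u \<le> M"
      and eq: "int a * int b * (m\<^sup>2 + n\<^sup>2) = 2 * int u"
      by (auto simp: wr_params_def)
    have "m\<^sup>2 + n\<^sup>2 \<noteq> 0"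
    proof
      assume "m\<^sup>2 + n\<^sup>2 = 0"
      hence "2 * int u = 0" unfolding eq[symmetric] by simp
      thus False using u by simp
    qed
    hence pos: "m\<^sup>2 + n\<^sup>2 > 0" using sum_power2_ge_zero[of m n] by linarith
    have "a dvd 2 * u" "b dvd 2 * u"
    proof -
      have "int a dvd int (2 * u)" "int b dvd int (2 * u)" using eq[symmetric] by simp_all
      thus "a dvd 2 * u" "b dvd 2 * u" by (simp_all only: int_dvd_int_iff)
    qed
    hence "a \<le> 2 * u" "b \<le> 2 * u" using u by (auto intro: dvd_imp_le)
    hence "a \<in> I" "b \<in> I" using u ab by (auto simp: I_def)
    hence "((a, b), m, n) \<in> (SIGMA x:I \<times> I. R x)" using eq u pos by (simp add: R_def)
    thus "z \<in> (\<lambda>((a, b), m, n). (a, b, m, n)) ` (SIGMA x:I \<times> I. R x)"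
      unfolding z by (rule rev_image_eqI) simp
  qed
  have "(\<Sum>u\<in>{1..M}. WR_count u) \<le> (\<Sum>u\<in>{1..M}. card (wr_params u))"
    by (intro sum_mono WR_count_le_card_wr_params) auto
  also have "\<dots> = card (\<Union>u\<in>{1..M}. wr_params u)"
  proof (rule card_UN_disjoint[symmetric])
    show "\<forall>u\<in>{1..M}. finite (wr_params u)" by (simp add: wr_params_bound(1))
    show "\<forall>u\<in>{1..M}. \<forall>v\<in>{1..M}. u \<noteq> v \<longrightarrow> wr_params u \<inter> wr_params v = {}"
      by (auto simp: wr_params_def)
  qed simp
  also have "\<dots> \<le> card (SIGMA x:I \<times> I. R x)"
    by (rule order_trans[OF card_mono[OF finite_imageI[OF fS] sub] card_image_le[OF fS]])
  also have "\<dots> = (\<Sum>x\<in>I \<times> I. card (R x))"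
    using fI R by (intro card_SigmaI) auto
  finally have "real (\<Sum>u\<in>{1..M}. WR_count u) \<le> real (\<Sum>x\<in>I \<times> I. card (R x))"
    by (rule of_nat_mono)
  also have "\<dots> = (\<Sum>x\<in>I \<times> I. real (card (R x)))" by simp
  also have "\<dots> \<le> (\<Sum>(a, b)\<in>I \<times> I. 18 * real M * (inverse (real a) * inverse (real b)))"
    using R by (intro sum_mono) auto
  also have "\<dots> = 18 * real M * (\<Sum>a\<in>I. \<Sum>b\<in>I. inverse (real a) * inverse (real b))"
    by (simp add: sum.cartesian_product[symmetric] sum_distrib_left)
  also have "(\<Sum>a\<in>I. \<Sum>b\<in>I. inverse (real a) * inverse (real b)) = harm (2 * M) ^ 2"
    by (simp add: harm_def I_def power2_eq_square sum_product)
  finally show ?thesis .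
qed

section \<open>From the average count to density zero\<close>

lemma harm_le_ln:
  assumes "n > 0"
  shows "harm n \<le> 1 + ln (real n)"
proof -
  obtain k where n: "n = Suc k" using assms by (cases n) auto
  show ?thesis using decseqD[OF decseq_harm_diff_ln, of 0 k] by (simp add: n harm_def)
qed

lemma ln_8_gt_2: "ln 8 > (2::real)"
proof -
  have "exp (2::real) = exp 1 ^ 2" by (simp flip: exp_of_nat_mult)
  also have "\<dots> \<le> (272 / 100) ^ 2" using e_less_272 by (intro power_mono) auto
  also have "\<dots> < (8::real)" by (simp add: power2_eq_square)
  finally have "ln (exp (2::real)) < ln 8" by (subst ln_less_cancel_iff) auto
  thus ?thesis by simp
qed

lemma log_power_quotient_tendsto_0:
  fixes c :: real
  assumes "c > 2"
  shows "(\<lambda>M. sqrt (real M) / real M + 18 * (1 + ln (2 * real M)) ^ 2 / (ln (real M) / 2) powr c) \<longlonglongrightarrow> 0"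
  using assms by real_asymp

text \<open>Numbers with \<open>n\<^sup>2 \<le> M\<close> number at most \<open>sqrt M\<close>. For
  the others \<open>ln n \<ge> ln M / 2\<close>, so one threshold \<open>T\<close> serves them all
  and Markov's inequality applies. The average has order \<open>(ln M)\<^sup>2\<close>, which is why
  \<open>c > 2\<close> is enough.\<close>

lemma density_zero_large_WR_count:
  fixes c :: real
  assumes "c > 2"
  shows "density_zero {u. real u \<in> WR_dets \<and> real (WR_count u) > ln (real u) powr c}"
proof -
  define P where "P = {u. real u \<in> WR_dets \<and> real (WR_count u) > ln (real u) powr c}"
  define g where "g = (\<lambda>M. sqrt (real M) / real M + 18 * (1 + ln (2 * real M)) ^ 2 / (ln (real M) / 2) powr c)"
  have pos: "u > 0" if "u \<in> P" for u
    using that covolume_pos by (force simp: P_def WR_dets_def WR_Z2_def)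
  have bound: "real (card {n \<in> P. n \<le> M}) / real M \<le> g M" if M: "M \<ge> 2" for M
  proof -
    define T where "T = (ln (real M) / 2) powr c"
    define A where "A = {n \<in> P. n\<^sup>2 \<le> M}"
    define B where "B = {n \<in> P. n \<le> M \<and> n\<^sup>2 > M}"
    have lnM: "ln (real M) > 0" using M by simp
    have T: "T > 0" using lnM by (simp add: T_def)
    have "real (card A) \<le> sqrt (real M)"
    proof -
      have "A \<subseteq> {1..nat \<lfloor>sqrt (real M)\<rfloor>}"
      proof
        fix n assume n: "n \<in> A"
        hence "real (n\<^sup>2) \<le> real M" unfolding of_nat_le_iff by (simp add: A_def)
        hence "real n \<le> sqrt (real M)" by (intro real_le_rsqrt) simp
        thus "n \<in> {1..nat \<lfloor>sqrt (real M)\<rfloor>}" using n pos[of n] by (simp add: A_def le_nat_floor)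
      qed
      from card_mono[OF _ this] have "card A \<le> nat \<lfloor>sqrt (real M)\<rfloor>" by simp
      thus ?thesis by (simp add: le_nat_iff le_floor_iff)
    qed
    have "real (card B) * T = (\<Sum>u\<in>B. T)" by simp
    also have "\<dots> \<le> (\<Sum>u\<in>B. real (WR_count u))"
    proof (rule sum_mono)
      fix u assume u: "u \<in> B"
      have u0: "u > 0" using u pos by (simp add: B_def)
      have "real M \<le> real (u\<^sup>2)" using u unfolding of_nat_le_iff by (simp add: B_def)
      hence "ln (real M) \<le> ln (real (u\<^sup>2))" using M by (intro ln_mono) auto
      also have "\<dots> = 2 * ln (real u)" using u0 by (simp add: ln_realpow)
      finally have "T \<le> ln (real u) powr c" unfolding T_def using lnM assms by (intro powr_mono2) auto
      also have "\<dots> \<le> real (WR_count u)" using u by (simp add: B_def P_def)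
      finally show "T \<le> real (WR_count u)" .
    qed
    also have "\<dots> \<le> (\<Sum>u\<in>{1..M}. real (WR_count u))"
      using pos by (intro sum_mono2) (auto simp: B_def Suc_le_eq)
    also have "\<dots> \<le> 18 * real M * harm (2 * M) ^ 2" using sum_WR_count_le[of M] by simp
    also have "\<dots> \<le> 18 * real M * (1 + ln (2 * real M)) ^ 2"
      using harm_le_ln[of "2 * M"] M harm_nonneg[of "2 * M", where ?'a = real]
      by (intro mult_left_mono power_mono) auto
    finally have B: "real (card B) \<le> 18 * real M * (1 + ln (2 * real M)) ^ 2 / T"
      using T by (simp add: pos_le_divide_eq)
    have "{n \<in> P. n \<le> M} \<subseteq> A \<union> B" by (auto simp: A_def B_def)
    moreover have "finite A" "finite B"
      by (rule finite_subset[of _ "{..M}"]; auto simp: A_def B_def power2_nat_le_imp_le)+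
    ultimately have "card {n \<in> P. n \<le> M} \<le> card A + card B"
      using card_mono[of "A \<union> B"] card_Un_le[of A B] by (metis finite_UnI order_trans)
    hence "real (card {n \<in> P. n \<le> M}) \<le> sqrt (real M) + 18 * real M * (1 + ln (2 * real M)) ^ 2 / T"
      using B \<open>real (card A) \<le> sqrt (real M)\<close> by linarith
    hence "real (card {n \<in> P. n \<le> M}) / real M \<le> (sqrt (real M) + 18 * real M * (1 + ln (2 * real M)) ^ 2 / T) / real M"
      by (rule divide_right_mono) simp
    also have "\<dots> = g M" using M by (simp add: g_def T_def add_divide_distrib)
    finally show ?thesis .
  qed
  have "(\<lambda>M. real (card {n \<in> P. n \<le> M}) / real M) \<longlonglongrightarrow> 0"
  proof (rule tendsto_sandwich[OF _ _ tendsto_const])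
    show "g \<longlonglongrightarrow> 0" unfolding g_def by (rule log_power_quotient_tendsto_0[OF assms])
    show "\<forall>\<^sub>F M in sequentially. real (card {n \<in> P. n \<le> M}) / real M \<le> g M"
      using bound by (rule eventually_sequentiallyI)
  qed simp
  thus ?thesis unfolding density_zero_def P_def .
qed

section \<open>Products of primes with many balanced divisors\<close>

text \<open>The recurrence of Leibniz's harmonic triangle, whose entry in row \<open>n\<close> and
  column \<open>k\<close> is the reciprocal of \<open>(n + 1) * (n choose k)\<close>.\<close>

lemma leibniz_triangle:
  assumes "k \<le> n"
  shows "inverse (real (Suc (Suc n) * (Suc n choose Suc k))) =
    inverse (real (Suc n * (n choose k))) - inverse (real (Suc (Suc n) * (Suc n choose k)))"
proof -
  obtain d where n: "n = k + d" using assms le_Suc_ex by blast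
  have inv: "inverse (real (Suc m * (m choose j))) = fact j * fact (m - j) / fact (Suc m)" if "j \<le> m" for j m
    using that by (simp add: binomial_fact field_simps)
  have 1: "inverse (real (Suc (Suc n) * (Suc n choose Suc k))) = fact (Suc k) * fact d / fact (Suc (Suc n))"
    using inv[of "Suc k" "Suc n"] by (simp add: n)
  have 2: "inverse (real (Suc n * (n choose k))) = fact k * fact d / fact (Suc n)"
    using inv[of k n] by (simp add: n)
  have 3: "inverse (real (Suc (Suc n) * (Suc n choose k))) = fact k * fact (Suc d) / fact (Suc (Suc n))"
    using inv[of k "Suc n"] by (simp add: n Suc_diff_le)
  have f: "(fact (Suc (Suc n)) :: real) = (real k + real d + 2) * fact (Suc n)"
    "(fact (Suc k) :: real) = (real k + 1) * fact k" "(fact (Suc d) :: real) = (real d + 1) * fact d"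
    by (simp_all add: n algebra_simps)
  have "(x + 1) * A * D / ((x + y + 2) * F) = A * D / F - A * ((y + 1) * D) / ((x + y + 2) * F)"
    if "F > 0" "x \<ge> 0" "y \<ge> 0" for x y A D F :: real
    using that by (simp add: divide_simps) (simp add: algebra_simps)
  thus ?thesis unfolding 1 2 3 f by simp
qed

text \<open>By the recurrence every entry of row \<open>n\<close> is an integer combination of
  reciprocals of \<open>1, ..., n + 1\<close>, so their least common multiple clears its
  denominator. Equivalently, \<open>(n + 1) * (n choose k)\<close> divides that multiple.\<close>

lemma Lcm_div_leibniz_Ints:
  assumes "k \<le> n"
  shows "real (Lcm {1..Suc n}) * inverse (real (Suc n * (n choose k))) \<in> \<int>"
  using assms
proof (induction k arbitrary: n)
  case 0
  have "Suc n dvd Lcm {1..Suc n}" by (rule dvd_Lcm) simp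
  then obtain q where "Lcm {1..Suc n} = Suc n * q" by (rule dvdE)
  hence "real (Lcm {1..Suc n}) = real (Suc n) * real q" by (simp only: of_nat_mult)
  hence "real (Lcm {1..Suc n}) * inverse (real (Suc n * (n choose 0))) = real q"
    by (simp add: field_simps del: of_nat_Suc)
  thus ?case by simp
next
  case (Suc k)
  then obtain m where n: "n = Suc m" and m: "k \<le> m" by (cases n) auto
  have "Lcm {1..Suc m} dvd Lcm {1..Suc n}" by (rule Lcm_subset) (auto simp: n)
  then obtain q where q: "Lcm {1..Suc n} = Lcm {1..Suc m} * q" by (rule dvdE)
  have "real (Lcm {1..Suc n}) * inverse (real (Suc m * (m choose k))) =
    real q * (real (Lcm {1..Suc m}) * inverse (real (Suc m * (m choose k))))"
    unfolding q by simp
  also have "\<dots> \<in> \<int>" by (rule Ints_mult[OF Ints_of_nat Suc.IH[OF m]])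
  finally have 1: "real (Lcm {1..Suc n}) * inverse (real (Suc m * (m choose k))) \<in> \<int>" .
  have 2: "real (Lcm {1..Suc n}) * inverse (real (Suc n * (n choose k))) \<in> \<int>"
    using Suc.IH[of n] m n by simp
  have "real (Lcm {1..Suc n}) * inverse (real (Suc n * (n choose Suc k))) =
    real (Lcm {1..Suc n}) * inverse (real (Suc m * (m choose k))) -
    real (Lcm {1..Suc n}) * inverse (real (Suc n * (n choose k)))"
    unfolding n leibniz_triangle[OF m] by (rule right_diff_distrib)
  thus ?case using 1 2 by (simp only: Ints_diff)
qed

text \<open>The central binomial coefficient is the largest of the \<open>n + 1\<close> terms
  summing to \<open>2 ^ n\<close>, and \<open>n + 1\<close> times it divides the least common
  multiple.\<close>

lemma two_power_le_Lcm: "2 ^ n \<le> Lcm {1..Suc n}"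
proof -
  define D where "D = Suc n * (n choose (n div 2))"
  have "D > 0" by (simp add: D_def)
  have "2 ^ n = (\<Sum>k\<le>n. n choose k)" by (simp add: choose_row_sum)
  also have "\<dots> \<le> (\<Sum>k\<le>n. n choose (n div 2))" by (intro sum_mono binomial_maximum)
  also have "\<dots> = D" by (simp add: D_def)
  finally have "2 ^ n \<le> D" .
  also have "D dvd Lcm {1..Suc n}"
  proof -
    have "real (Lcm {1..Suc n}) * inverse (real D) \<in> \<int>"
      unfolding D_def by (rule Lcm_div_leibniz_Ints) simp
    then obtain z where "real (Lcm {1..Suc n}) * inverse (real D) = of_int z" by (rule Ints_cases)
    hence "real_of_int (int (Lcm {1..Suc n})) = real_of_int (z * int D)"
      using \<open>D > 0\<close> by (simp add: field_simps)
    hence "int (Lcm {1..Suc n}) = z * int D" unfolding of_int_eq_iff .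
    hence "int D dvd int (Lcm {1..Suc n})" by simp
    thus ?thesis by (simp only: int_dvd_int_iff)
  qed
  hence "D \<le> Lcm {1..Suc n}" by (rule dvd_imp_le) (auto simp: Lcm_0_iff intro!: Nat.gr0I)
  finally show ?thesis .
qed

text \<open>Each prime power in the least common multiple already divides a single
  \<open>j \<le> m\<close>, so it is at most \<open>m\<close>.\<close>

lemma Lcm_le_power_card_primes:
  fixes m :: nat
  assumes "m > 0"
  shows "Lcm {1..m} \<le> m ^ card {p. prime p \<and> p \<le> m}"
proof -
  define Q where "Q = {p. prime p \<and> p \<le> m}"
  define f where "f = (\<lambda>p::nat. Max ((\<lambda>j. multiplicity p j) ` {1..m}))"
  have fQ: "finite Q" by (rule finite_subset[of _ "{..m}"]) (auto simp: Q_def)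
  have "Lcm {1..m} dvd (\<Prod>p\<in>Q. p ^ f p)"
  proof (rule Lcm_least)
    fix j assume j: "j \<in> {1..m}"
    show "j dvd (\<Prod>p\<in>Q. p ^ f p)"
    proof (rule multiplicity_le_imp_dvd)
      show "j \<noteq> 0" using j by simp
      fix p :: nat assume p: "prime p"
      show "multiplicity p j \<le> multiplicity p (\<Prod>p\<in>Q. p ^ f p)"
      proof (cases "p dvd j")
        case True
        hence "p \<le> j" using j by (intro dvd_imp_le) auto
        hence pQ: "p \<in> Q" using p j by (simp add: Q_def)
        have "multiplicity p j \<le> f p" unfolding f_def using j by (intro Max_ge) auto
        hence "p ^ multiplicity p j dvd p ^ f p" by (rule le_imp_power_dvd)
        also have "p ^ f p dvd (\<Prod>p\<in>Q. p ^ f p)" using fQ pQ by (rule dvd_prodI)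
        finally show ?thesis
          using p by (intro multiplicity_geI) (auto simp: prod_zero_iff fQ Q_def)
      qed (simp add: not_dvd_imp_multiplicity_0)
    qed
  qed
  hence "Lcm {1..m} \<le> (\<Prod>p\<in>Q. p ^ f p)"
    by (rule dvd_imp_le) (auto intro!: prod_pos simp: Q_def prime_gt_0_nat)
  also have "\<dots> \<le> (\<Prod>p\<in>Q. m)"
  proof (rule prod_mono)
    fix p assume "p \<in> Q"
    have "f p \<in> (\<lambda>j. multiplicity p j) ` {1..m}" unfolding f_def using assms by (intro Max_in) auto
    then obtain j where j: "j \<in> {1..m}" "f p = multiplicity p j" by auto
    have "p ^ f p \<le> j" using j(1) unfolding j(2) by (intro dvd_imp_le multiplicity_dvd) auto
    thus "0 \<le> p ^ f p \<and> p ^ f p \<le> m" using j(1) by simp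
  qed
  finally show ?thesis by (simp add: Q_def)
qed

lemma square_less_two_power: "r\<^sup>2 < 2 ^ (r + 1)" for r :: nat
proof (induction r)
  case (Suc r)
  show ?case
  proof (cases "r < 3")
    case True
    then consider "r = 0" | "r = 1" | "r = 2" by linarith
    thus ?thesis by cases (simp_all add: power2_eq_square)
  next
    case False
    hence "r * 3 \<le> r * r" by simp
    hence "2 * r + 1 \<le> r\<^sup>2" using False unfolding power2_eq_square by linarith
    hence "(Suc r)\<^sup>2 \<le> 2 * r\<^sup>2" by (simp add: power2_eq_square)
    thus ?thesis using Suc by simp
  qed
qed simp

text \<open>A Chebyshev-type bound. With fewer than \<open>r\<close> primes, the least common
  multiple of the numbers up to \<open>r\<^sup>2\<close> would be at most
  \<open>(r\<^sup>2) ^ (r - 1)\<close>, which is less than its lower bound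
  \<open>2 ^ ((r + 1) * (r - 1))\<close>.\<close>

lemma card_primes_le_square:
  assumes "r \<ge> 2"
  shows "r \<le> card {p::nat. prime p \<and> p \<le> r\<^sup>2}"
proof (rule ccontr)
  define c where "c = card {p::nat. prime p \<and> p \<le> r\<^sup>2}"
  assume "\<not> ?thesis"
  hence c: "c \<le> r - 1" unfolding c_def by simp
  obtain s where s: "r = Suc s" using assms by (cases r) auto
  have r2: "r\<^sup>2 = Suc ((r + 1) * (r - 1))" by (simp add: s power2_eq_square)
  have "2 ^ ((r + 1) * (r - 1)) \<le> Lcm {1..r\<^sup>2}" unfolding r2 by (rule two_power_le_Lcm)
  also have "\<dots> \<le> (r\<^sup>2) ^ c" unfolding c_def using assms by (intro Lcm_le_power_card_primes) simp
  also have "\<dots> \<le> (r\<^sup>2) ^ (r - 1)" using c assms by (intro power_increasing) auto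
  also have "\<dots> < (2 ^ (r + 1)) ^ (r - 1)"
    using square_less_two_power[of r] assms by (intro power_strict_mono) auto
  finally show False by (simp only: power_mult less_irrefl)
qed

text \<open>Take the product of \<open>r\<close> distinct primes up to \<open>r\<^sup>2\<close>;
  different subsets of these primes have different products.\<close>

lemma ex_many_divisors:
  assumes "r \<ge> 2"
  obtains w where "w > 0" "w \<le> (r\<^sup>2) ^ r" "num_prime_divisors w \<le> r" "2 ^ r \<le> num_divisors w"
proof -
  obtain S where S: "S \<subseteq> {p::nat. prime p \<and> p \<le> r\<^sup>2}" "card S = r" "finite S"
    using obtain_subset_with_card_n[OF card_primes_le_square[OF assms]] by blast
  have prime: "prime p" if "p \<in> S" for p using S that by auto
  define w where "w = \<Prod>S"
  have w: "w > 0" unfolding w_def using prime by (intro prod_pos) (auto simp: prime_gt_0_nat)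
  have "w \<le> (\<Prod>p\<in>S. r\<^sup>2)" unfolding w_def using S by (intro prod_mono) auto
  hence 1: "w \<le> (r\<^sup>2) ^ r" by (simp add: S)
  have mem: "p \<in> T" if T: "prime p" "p dvd \<Prod>T" "T \<subseteq> S" for p T
  proof -
    have "finite T" using S T by (metis finite_subset)
    then obtain q where q: "q \<in> T" "p dvd q" using T prime_dvd_prod_iff[of T p "\<lambda>x. x"] by auto
    have "p = q" using q T prime by (intro primes_dvd_imp_eq) auto
    thus ?thesis using q by simp
  qed
  have "{p. prime p \<and> p dvd w} \<subseteq> S" using mem[of _ S] by (auto simp: w_def)
  hence 2: "num_prime_divisors w \<le> r"
    unfolding num_prime_divisors_def using card_mono[OF S(3)] S(2) by metis
  have "inj_on Prod (Pow S)"
  proof (rule inj_onI)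
    have *: "T \<subseteq> U" if "T \<in> Pow S" "U \<in> Pow S" "\<Prod>T = \<Prod>U" for T U
    proof
      fix p assume p: "p \<in> T"
      have "finite T" using S that by (auto intro: finite_subset)
      hence "p dvd \<Prod>T" using p dvd_prodI[of T p "\<lambda>x. x"] by simp
      thus "p \<in> U" using that p prime[of p] by (intro mem) auto
    qed
    fix T U assume "T \<in> Pow S" "U \<in> Pow S" "\<Prod>T = \<Prod>U"
    thus "T = U" using *[of T U] *[of U T] by auto
  qed
  moreover have "Prod ` Pow S \<subseteq> {d. d dvd w}"
    unfolding w_def using S(3) by (auto intro: prod_dvd_prod_subset)
  ultimately have "card (Pow S) \<le> num_divisors w"
    unfolding num_divisors_def using w by (intro card_inj_on_le) auto
  hence 3: "2 ^ r \<le> num_divisors w" using S by (simp add: card_Pow)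
  show ?thesis using that w 1 2 3 .
qed

section \<open>Balancing divisors by powers of 3\<close>

lemma finite_balanced_divisors: "c > 0 \<Longrightarrow> finite (balanced_divisors c)"
  by (rule finite_subset[of _ "{..c}"]) (auto simp: balanced_divisors_def dvd_imp_le)

lemma card_balanced_divisors_scale:
  assumes "c > 0" "d > 0"
  shows "card (balanced_divisors c) \<le> card (balanced_divisors (d\<^sup>2 * c))"
proof (rule card_inj_on_le[of "\<lambda>a. d * a"])
  show "inj_on (\<lambda>a. d * a) (balanced_divisors c)" using assms by (simp add: inj_on_def)
  show "finite (balanced_divisors (d\<^sup>2 * c))" using assms by (intro finite_balanced_divisors) simp
  show "(\<lambda>a. d * a) ` balanced_divisors c \<subseteq> balanced_divisors (d\<^sup>2 * c)"
  proof (rule image_subsetI)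
    fix a assume a: "a \<in> balanced_divisors c"
    then obtain b where b: "c = a * b" by (auto simp: balanced_divisors_def)
    have ab: "a > 0" "b > 0" using assms b by auto
    have c1: "c div a = b" using ab by (simp add: b)
    have "d\<^sup>2 * c = (d * a) * (d * b)" by (simp add: b power2_eq_square)
    hence c2: "d\<^sup>2 * c div (d * a) = d * b" "d * a dvd d\<^sup>2 * c" using ab assms by simp_all
    have ineq: "b\<^sup>2 \<le> 3 * a\<^sup>2" "a\<^sup>2 \<le> 3 * b\<^sup>2" using a c1 by (auto simp: balanced_divisors_def)
    have "d\<^sup>2 * b\<^sup>2 \<le> d\<^sup>2 * (3 * a\<^sup>2)" "d\<^sup>2 * a\<^sup>2 \<le> d\<^sup>2 * (3 * b\<^sup>2)"
      using ineq by (auto intro: mult_left_mono)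
    thus "d * a \<in> balanced_divisors (d\<^sup>2 * c)"
      unfolding balanced_divisors_def mem_Collect_eq c2(1) using c2(2) by (simp add: power_mult_distrib)
  qed
qed

text \<open>Passing to the cofactor exchanges the divisors below and above the square root.
  Restricting to the upper ones means that only the cofactor ever has to be enlarged.\<close>

lemma num_divisors_le_large_divisors:
  assumes "w > 0"
  shows "num_divisors w \<le> 2 * card {a. a dvd w \<and> w \<le> a\<^sup>2}"
proof -
  define H where "H = {a. a dvd w \<and> w \<le> a\<^sup>2}"
  have fH: "finite H" by (rule finite_subset[of _ "{..w}"]) (use assms in \<open>auto simp: H_def dvd_imp_le\<close>)
  have "{d. d dvd w} \<subseteq> H \<union> (\<lambda>a. w div a) ` H"
  proof
    fix a assume "a \<in> {d. d dvd w}"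
    then obtain d where d: "w = a * d" by auto
    have "w \<le> a\<^sup>2 \<or> w \<le> d\<^sup>2"
    proof (cases "a \<le> d")
      case True thus ?thesis by (simp add: d power2_eq_square)
    next
      case False thus ?thesis by (simp add: d power2_eq_square)
    qed
    moreover have "a = w div d" using assms d by simp
    moreover have "a dvd w" "d dvd w" using d by auto
    ultimately show "a \<in> H \<union> (\<lambda>a. w div a) ` H" unfolding H_def by blast
  qed
  hence "num_divisors w \<le> card (H \<union> (\<lambda>a. w div a) ` H)"
    unfolding num_divisors_def using fH by (intro card_mono) auto
  also have "\<dots> \<le> card H + card ((\<lambda>a. w div a) ` H)" by (rule card_Un_le)
  also have "\<dots> \<le> card H + card H" using fH by (intro add_left_mono card_image_le)
  finally show ?thesis by (simp add: H_def)
qed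

text \<open>For \<open>w = a * d\<close> with \<open>a \<ge> d\<close>, some power
  \<open>3 ^ j\<close> brings \<open>3 ^ j * d\<close> within a factor \<open>sqrt 3\<close> of
  \<open>a\<close>. Only the \<open>B + 1\<close> exponents up to \<open>B\<close> occur, so one of
  them serves many divisors at once.\<close>

lemma balanced_divisors_pigeonhole:
  assumes w: "w > 0" "w < 2 ^ B"
  obtains j where "j \<le> B" "num_divisors w \<le> 2 * (B + 1) * card (balanced_divisors (3 ^ j * w))"
proof -
  define H where "H = {a. a dvd w \<and> w \<le> a\<^sup>2}"
  have fH: "finite H" by (rule finite_subset[of _ "{..w}"]) (use w in \<open>auto simp: H_def dvd_imp_le\<close>)
  \<comment> \<open>Since \<open>w = a * d\<close>, the condition says
    \<open>a\<^sup>2 < 3 * (3 ^ j * d)\<^sup>2\<close>, written without \<open>d\<close>. Its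
    failure at \<open>j - 1\<close> says \<open>(3 ^ j * d)\<^sup>2 \<le> 3 * a\<^sup>2\<close>, so
    the least \<open>j\<close> is balanced on both sides.\<close>
  define f where "f = (\<lambda>a. LEAST j. 3 * (a\<^sup>2 * a\<^sup>2) < 9 ^ (j + 1) * w\<^sup>2)"
  have B: "3 * (a\<^sup>2 * a\<^sup>2) < 9 ^ (B + 1) * w\<^sup>2" if "a \<in> H" for a
  proof -
    have "a dvd w" using that by (simp add: H_def)
    hence "a > 0" "a \<le> w" using w by (auto intro: dvd_imp_le Nat.gr0I)
    have "a < 2 ^ B" using \<open>a \<le> w\<close> w by simp
    hence "a\<^sup>2 \<le> (2 ^ B)\<^sup>2" by (intro power_mono) auto
    hence "a\<^sup>2 \<le> 4 ^ B" by (simp add: power_mult_distrib power2_eq_square flip: power_mult_distrib)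
    hence "a\<^sup>2 * a\<^sup>2 \<le> 4 ^ B * w\<^sup>2" using \<open>a \<le> w\<close> by (intro mult_mono power_mono) auto
    also have "\<dots> \<le> 9 ^ B * w\<^sup>2" by (intro mult_right_mono power_mono) auto
    finally have "3 * (a\<^sup>2 * a\<^sup>2) \<le> 3 * (9 ^ B * w\<^sup>2)" by simp
    also have "\<dots> < 9 * (9 ^ B * w\<^sup>2)" using w by simp
    finally show ?thesis by simp
  qed
  have "f \<in> H \<rightarrow> {0..B}"
    using Least_le[of "\<lambda>j. 3 * (a\<^sup>2 * a\<^sup>2) < 9 ^ (j + 1) * w\<^sup>2" B for a, OF B] by (simp add: f_def)
  from pigeonhole_card[OF this fH] obtain j where j: "j \<le> B" "card H \<le> card (f -` {j} \<inter> H) * (B + 1)"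
    by auto
  have "f -` {j} \<inter> H \<subseteq> balanced_divisors (3 ^ j * w)"
  proof
    fix a assume "a \<in> f -` {j} \<inter> H"
    hence a: "a \<in> H" "f a = j" by auto
    then obtain d where d: "w = a * d" by (auto simp: H_def)
    have a0: "a > 0" using w d by auto
    have up: "3 * (a\<^sup>2 * a\<^sup>2) < 9 ^ (j + 1) * w\<^sup>2"
      using LeastI[of "\<lambda>j. 3 * (a\<^sup>2 * a\<^sup>2) < 9 ^ (j + 1) * w\<^sup>2", OF B[OF a(1)]] a(2) by (simp add: f_def)
    have lo: "9 ^ j * w\<^sup>2 \<le> 3 * (a\<^sup>2 * a\<^sup>2)"
    proof (cases j)
      case 0
      \<comment> \<open>With no smaller exponent to compare with, the lower bound comes from
        \<open>w \<le> a\<^sup>2\<close>.\<close>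
      have "w * w \<le> a\<^sup>2 * a\<^sup>2" using a(1) by (intro mult_mono) (auto simp: H_def)
      thus ?thesis by (simp add: 0 power2_eq_square)
    next
      case (Suc i)
      have "\<not> 3 * (a\<^sup>2 * a\<^sup>2) < 9 ^ (i + 1) * w\<^sup>2"
        using not_less_Least[of i "\<lambda>j. 3 * (a\<^sup>2 * a\<^sup>2) < 9 ^ (j + 1) * w\<^sup>2"] a(2) Suc by (simp add: f_def)
      thus ?thesis by (simp add: Suc)
    qed
    have nine: "(3 ^ j)\<^sup>2 = (9 ^ j :: nat)" by (simp add: power2_eq_square flip: power_mult_distrib)
    have ww: "w\<^sup>2 = a\<^sup>2 * d\<^sup>2" by (simp add: d power_mult_distrib)
    have "a\<^sup>2 * (3 ^ j * d)\<^sup>2 \<le> a\<^sup>2 * (3 * a\<^sup>2)"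
      using lo by (simp add: ww power_mult_distrib nine mult_ac)
    hence 1: "(3 ^ j * d)\<^sup>2 \<le> 3 * a\<^sup>2" using a0 by simp
    have "a\<^sup>2 * (3 * a\<^sup>2) \<le> a\<^sup>2 * (3 * (3 * (3 ^ j * d)\<^sup>2))"
      using up by (simp add: ww power_mult_distrib nine mult_ac)
    hence 2: "a\<^sup>2 \<le> 3 * (3 ^ j * d)\<^sup>2" using a0 by simp
    have "3 ^ j * w div a = 3 ^ j * d" "a dvd 3 ^ j * w" using a0 by (simp_all add: d)
    thus "a \<in> balanced_divisors (3 ^ j * w)" unfolding balanced_divisors_def using 1 2 by simp
  qed
  hence "card (f -` {j} \<inter> H) \<le> card (balanced_divisors (3 ^ j * w))"
    using w by (intro card_mono finite_balanced_divisors) auto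
  hence "card (f -` {j} \<inter> H) * (B + 1) \<le> card (balanced_divisors (3 ^ j * w)) * (B + 1)"
    by (rule mult_right_mono) simp
  hence "2 * card H \<le> 2 * (card (balanced_divisors (3 ^ j * w)) * (B + 1))" using j(2) by linarith
  moreover have "num_divisors w \<le> 2 * card H"
    unfolding H_def by (rule num_divisors_le_large_divisors[OF w(1)])
  ultimately have "num_divisors w \<le> 2 * (B + 1) * card (balanced_divisors (3 ^ j * w))"
    by (simp only: mult_ac)
  with j(1) that show ?thesis by blast
qed

section \<open>Determinants with many lattices\<close>

text \<open>The number of binary digits, an integer substitute for the logarithm to base 2.\<close>

definition bit_count :: "nat \<Rightarrow> nat" where
  "bit_count k = (LEAST l. k < 2 ^ l)"

lemma less_two_power_bit_count: "k < 2 ^ bit_count k"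
  unfolding bit_count_def by (rule LeastI[of _ k]) simp

lemma bit_count_mono: "k \<le> k' \<Longrightarrow> bit_count k \<le> bit_count k'"
  unfolding bit_count_def[of k]
  by (rule Least_le) (rule le_less_trans[OF _ less_two_power_bit_count])

lemma bit_count_ge_2:
  assumes "k \<ge> 2"
  shows "bit_count k \<ge> 2"
proof (rule ccontr)
  assume "\<not> ?thesis"
  hence "(2::nat) ^ bit_count k \<le> 2 ^ 1" by (intro power_increasing) auto
  thus False using less_two_power_bit_count[of k] assms by simp
qed

text \<open>For \<open>k \<ge> 2\<close>,
  \<open>2 ^ bit_count k \<le> 2 * k \<le> k\<^sup>2\<close>; the constant is
  \<open>2 / (2 / 3)\<close>.\<close>

lemma bit_count_le_ln:
  assumes "k \<ge> 2"
  shows "real (bit_count k) \<le> 3 * ln (real k)"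
proof -
  obtain l where l: "bit_count k = Suc l" using bit_count_ge_2[OF assms] by (cases "bit_count k") auto
  have "\<not> k < 2 ^ l" using not_less_Least[of l "\<lambda>l. k < 2 ^ l"] l by (simp add: bit_count_def)
  hence "2 ^ bit_count k \<le> 2 * k" by (simp add: l)
  also have "\<dots> \<le> k\<^sup>2" using assms by (simp add: power2_eq_square)
  finally have "real (2 ^ bit_count k) \<le> real (k\<^sup>2)" unfolding of_nat_le_iff .
  hence "ln (real (2 ^ bit_count k)) \<le> ln (real (k\<^sup>2))" using assms by (intro ln_mono) auto
  hence *: "real (bit_count k) * ln 2 \<le> 2 * ln (real k)" using assms by (simp add: ln_realpow)
  have "real (bit_count k) * (2 / 3) \<le> real (bit_count k) * ln 2"
    by (intro mult_left_mono ln2_ge_two_thirds) simp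
  with * show ?thesis by linarith
qed

text \<open>With \<open>l = bit_count k\<close> and \<open>r = 16 * k * l\<close> primes this is
  \<open>8 * l * r\<close>, large enough that the product of the primes stays below 2 to this
  power.\<close>

definition det_exponent :: "nat \<Rightarrow> nat" where
  "det_exponent k = 128 * k * bit_count k ^ 2"

lemma det_exponent_strict_mono:
  assumes "2 \<le> k" "k < k'"
  shows "det_exponent k < det_exponent k'"
proof -
  have "bit_count k ^ 2 > 0" using bit_count_ge_2[OF assms(1)] by simp
  hence "det_exponent k < 128 * k' * bit_count k ^ 2" using assms by (simp add: det_exponent_def)
  also have "\<dots> \<le> det_exponent k'"
    unfolding det_exponent_def using assms by (intro mult_left_mono power_mono bit_count_mono) auto
  finally show ?thesis .
qed

lemma ln_4_le_2: "ln (4::real) \<le> 2"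
proof -
  have "ln (4::real) = ln (2 ^ 2)" by simp
  also have "\<dots> = 2 * ln 2" by (subst ln_realpow) auto
  finally show ?thesis using ln_2_less_1 by simp
qed

text \<open>The \<open>2 ^ r\<close> divisors outnumber the pigeonhole loss \<open>2 * B + 2\<close>
  times the target \<open>(4 * B + 2) ^ k\<close>. The target bounds \<open>(ln u) ^ k\<close>,
  because \<open>ln 4 \<le> 2\<close> and \<open>u \<le> 4 ^ (2 * B + 1)\<close>. The lower end of
  the interval serves to separate different \<open>k\<close>.\<close>

lemma many_WR_lattices:
  assumes k: "k \<ge> 2"
  obtains u where "4 ^ (2 * det_exponent k) < u" "u \<le> 4 ^ (2 * det_exponent k + 1)"
    "num_prime_divisors u \<le> 16 * k * bit_count k + 2"
    "real (WR_count u) \<ge> (4 * real (det_exponent k) + 2) ^ k"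
proof -
  define l where "l = bit_count k"
  \<comment> \<open>Here \<open>4 * B + 2\<close> fits into \<open>8 * l\<close> bits, so its power
    \<open>k + 1\<close> needs \<open>8 * l * (k + 1) \<le> 16 * k * l\<close> bits.\<close>
  define r where "r = 16 * k * l"
  define B where "B = det_exponent k"
  have l2: "l \<ge> 2" and kl: "k < 2 ^ l"
    unfolding l_def by (rule bit_count_ge_2[OF k], rule less_two_power_bit_count)
  have B: "B = 128 * k * l\<^sup>2" by (simp add: B_def det_exponent_def l_def)
  have r2: "r \<ge> 2" using k l2 by (simp add: r_def)
  have l_less: "l < 2 ^ l" by simp
  obtain w where w: "w > 0" "w \<le> (r\<^sup>2) ^ r" "num_prime_divisors w \<le> r" "2 ^ r \<le> num_divisors w"
    using ex_many_divisors[OF r2] .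
  have "w < 2 ^ B"
  proof -
    have "r < 2 ^ (4 + 2 * l)"
    proof -
      have "k * l < 2 ^ l * 2 ^ l" using kl l_less by (intro mult_strict_mono) auto
      also have "2 ^ l * 2 ^ l = (4 :: nat) ^ l" by (simp flip: power_mult_distrib)
      finally have "16 * (k * l) < 16 * 4 ^ l" by simp
      also have "16 * 4 ^ l = (2 :: nat) ^ (4 + 2 * l)" by (simp add: power_add power_mult)
      finally show ?thesis by (simp add: r_def mult.assoc)
    qed
    hence "r\<^sup>2 < (2 ^ (4 + 2 * l))\<^sup>2" by (intro power_strict_mono) auto
    also have "(2 ^ (4 + 2 * l))\<^sup>2 = (2 :: nat) ^ ((4 + 2 * l) * 2)" by (rule power_mult[symmetric])
    also have "(4 + 2 * l) * 2 = 8 + 4 * l" by simp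
    finally have "r\<^sup>2 < 2 ^ (8 + 4 * l)" .
    hence "(r\<^sup>2) ^ r < (2 ^ (8 + 4 * l)) ^ r" using r2 by (intro power_strict_mono) auto
    also have "\<dots> = 2 ^ ((8 + 4 * l) * r)" by (rule power_mult[symmetric])
    also have "\<dots> \<le> 2 ^ B"
    proof (rule power_increasing)
      have "(8 + 4 * l) * r \<le> (8 * l) * r" using l2 by (intro mult_right_mono) auto
      also have "\<dots> = B" by (simp add: r_def B power2_eq_square)
      finally show "(8 + 4 * l) * r \<le> B" .
    qed simp
    finally show ?thesis using w(2) by simp
  qed
  from balanced_divisors_pigeonhole[OF w(1) this] obtain j where j: "j \<le> B"
    and nd: "num_divisors w \<le> 2 * (B + 1) * card (balanced_divisors (3 ^ j * w))" .
  define c where "c = 3 ^ j * w"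
  have c0: "c > 0" using w by (simp add: c_def)
  have "2 * c \<le> 4 ^ (2 * B)"
  proof -
    have "(3::nat) ^ j \<le> 4 ^ j" by (rule power_mono) auto
    also have "\<dots> \<le> 4 ^ B" using j by (rule power_increasing) simp
    finally have "c \<le> 4 ^ B * 2 ^ B" unfolding c_def using \<open>w < 2 ^ B\<close> by (intro mult_mono) auto
    moreover have "B \<ge> 1" using k l2 by (simp add: B)
    hence "(2::nat) ^ 1 \<le> 2 ^ B" by (rule power_increasing) simp
    ultimately have "2 * c \<le> 2 ^ B * (4 ^ B * 2 ^ B)" by (intro mult_mono) auto
    also have "\<dots> = 4 ^ (2 * B)" by (simp add: power_mult power2_eq_square flip: power_mult_distrib)
    finally show ?thesis .
  qed
  \<comment> \<open>Starting from \<open>2 * c \<le> 4 ^ (2 * B)\<close>, the first power of 4 that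
    passes this mark overshoots it by at most a factor 4. Multiplying by a square keeps the balanced
    divisors.\<close>
  define i where "i = (LEAST i. 4 ^ (2 * B) < 4 ^ i * (2 * c))"
  have lo: "4 ^ (2 * B) < 4 ^ i * (2 * c)"
  proof -
    have "(4::nat) ^ (2 * B) * 1 < 4 ^ (2 * B) * (2 * c)" using c0 by (intro mult_strict_left_mono) auto
    hence "4 ^ (2 * B) < 4 ^ (2 * B) * (2 * c)" by (simp only: mult_1_right)
    thus ?thesis unfolding i_def by (rule LeastI)
  qed
  have hi: "4 ^ i * (2 * c) \<le> 4 ^ (2 * B + 1)"
  proof (cases i)
    case 0
    thus ?thesis using lo \<open>2 * c \<le> 4 ^ (2 * B)\<close> by simp
  next
    case (Suc i')
    have "\<not> 4 ^ (2 * B) < 4 ^ i' * (2 * c)"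
      using not_less_Least[of i' "\<lambda>i. 4 ^ (2 * B) < 4 ^ i * (2 * c)"] Suc by (simp add: i_def)
    hence "4 ^ i' * (2 * c) \<le> 4 ^ (2 * B)" by (simp only: not_less)
    hence "4 * (4 ^ i' * (2 * c)) \<le> 4 * 4 ^ (2 * B)" by (rule mult_left_mono) simp
    thus ?thesis unfolding Suc by simp
  qed
  define u where "u = 4 ^ i * (2 * c)"
  have four: "(2 ^ i)\<^sup>2 = (4 ^ i :: nat)" by (simp add: power2_eq_square flip: power_mult_distrib)
  have "num_prime_divisors u \<le> num_prime_divisors (2 ^ (2 * i + 1)) + (num_prime_divisors (3 ^ j) + num_prime_divisors w)"
  proof -
    have u: "u = 2 ^ (2 * i + 1) * (3 ^ j * w)" by (simp add: u_def c_def power_mult)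
    have "num_prime_divisors u \<le> num_prime_divisors (2 ^ (2 * i + 1)) + num_prime_divisors (3 ^ j * w)"
      unfolding u using w by (intro num_prime_divisors_mult_le) auto
    also have "num_prime_divisors (3 ^ j * w) \<le> num_prime_divisors (3 ^ j) + num_prime_divisors w"
      using w by (intro num_prime_divisors_mult_le) auto
    finally show ?thesis by simp
  qed
  \<comment> \<open>One each for the primes 2 and 3, and \<open>r\<close> for the product of
    primes.\<close>
  also have "\<dots> \<le> 1 + (1 + r)"
    by (intro add_mono num_prime_divisors_prime_power_le w) auto
  finally have omega: "num_prime_divisors u \<le> 16 * k * bit_count k + 2" by (simp add: r_def l_def)
  have "(2 * B + 2) * (4 * B + 2) ^ k \<le> (2 * B + 2) * WR_count u"
  proof -
    have "(2 * B + 2) * (4 * B + 2) ^ k \<le> (4 * B + 2) * (4 * B + 2) ^ k" by (rule mult_right_mono) auto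
    also have "\<dots> = (4 * B + 2) ^ (k + 1)" by simp
    also have "\<dots> \<le> (2 ^ (8 * l)) ^ (k + 1)"
    proof (rule power_mono)
      have "k * (l * l) \<le> 2 ^ l * (2 ^ l * 2 ^ l)" using kl l_less by (intro mult_mono) auto
      moreover have "k * (l * l) \<ge> 1" using k l2 by simp
      \<comment> \<open>The left side is \<open>512 * k * l\<^sup>2 + 2\<close>, and
        \<open>k * l\<^sup>2 \<ge> 1\<close> absorbs the 2. Later
        \<open>10 + 3 * l \<le> 8 * l\<close> uses \<open>l \<ge> 2\<close>.\<close>
      ultimately have "4 * B + 2 \<le> 1024 * (2 ^ l * (2 ^ l * 2 ^ l))" unfolding B power2_eq_square by linarith
      also have "2 ^ l * (2 ^ l * 2 ^ l) = (8 :: nat) ^ l" by (simp flip: power_mult_distrib)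
      also have "1024 * 8 ^ l = (2 :: nat) ^ (10 + 3 * l)" by (simp add: power_add power_mult)
      also have "\<dots> \<le> 2 ^ (8 * l)" using l2 by (intro power_increasing) auto
      finally show "4 * B + 2 \<le> 2 ^ (8 * l)" .
    qed simp
    also have "\<dots> = 2 ^ (8 * l * (k + 1))" by (rule power_mult[symmetric])
    also have "\<dots> \<le> 2 ^ r"
    proof (rule power_increasing)
      have "8 * l * (k + 1) \<le> 8 * l * (2 * k)" using k by (intro mult_left_mono) auto
      thus "8 * l * (k + 1) \<le> r" by (simp add: r_def mult_ac)
    qed simp
    also have "\<dots> \<le> num_divisors w" by (rule w(4))
    also have "\<dots> \<le> 2 * (B + 1) * card (balanced_divisors c)" unfolding c_def by (rule nd)
    also have "\<dots> \<le> 2 * (B + 1) * card (balanced_divisors ((2 ^ i)\<^sup>2 * c))"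
      using c0 by (intro mult_left_mono card_balanced_divisors_scale) auto
    also have "\<dots> \<le> 2 * (B + 1) * WR_count (2 * ((2 ^ i)\<^sup>2 * c))"
      using c0 by (intro mult_left_mono WR_count_double_ge) auto
    also have "2 * ((2 ^ i)\<^sup>2 * c) = u" by (simp add: u_def four)
    finally show ?thesis by simp
  qed
  hence "(4 * B + 2) ^ k \<le> WR_count u" unfolding mult_le_cancel1 by simp
  hence "real ((4 * B + 2) ^ k) \<le> real (WR_count u)" unfolding of_nat_le_iff .
  hence "real (WR_count u) \<ge> (4 * real B + 2) ^ k" by (simp add: add.commute)
  with lo hi omega that show ?thesis unfolding u_def[symmetric] B_def by blast
qed

text \<open>The intervals from \<open>many_WR_lattices\<close> are disjoint and increasing in
  \<open>k\<close>, which makes the sequence strictly monotone. The constants are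
  \<open>9216 = 8 * 128 * 9\<close> and \<open>51 = 17 * 3\<close>, from
  \<open>bit_count k \<le> 3 * ln k\<close>.\<close>

lemma WR_count_log_power_sequence:
  obtains u :: "nat \<Rightarrow> nat" where "strict_mono_on {1..} u"
    "\<And>k. k \<ge> 1 \<Longrightarrow> real (u k) \<in> WR_dets"
    "\<And>k. k \<ge> 1 \<Longrightarrow> real (WR_count (u k)) \<ge> ln (real (u k)) ^ k"
    "\<And>k. k \<ge> 1 \<Longrightarrow> real (u k) \<le> exp (9216 * (real k * ln (real k) ^ 2))"
    "\<And>k. k \<ge> 1 \<Longrightarrow> real (num_prime_divisors (u k)) \<le> 51 * (real k * ln (real k))"
proof -
  define good where "good = (\<lambda>k u. 4 ^ (2 * det_exponent k) < u \<and> u \<le> 4 ^ (2 * det_exponent k + 1) \<and>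
    num_prime_divisors u \<le> 16 * k * bit_count k + 2 \<and> real (WR_count u) \<ge> (4 * real (det_exponent k) + 2) ^ k)"
  have "\<exists>u. k \<ge> 2 \<longrightarrow> good k u" for k
    using many_WR_lattices[of k] unfolding good_def by metis
  then obtain v where v: "\<And>k. k \<ge> 2 \<Longrightarrow> good k (v k)" by metis
  \<comment> \<open>The value 1 at \<open>k = 1\<close> is forced: \<open>ln 1 = 0\<close> turns the
    size bound into \<open>u 1 \<le> 1\<close>.\<close>
  define u where "u = (\<lambda>k. if k \<ge> 2 then v k else 1)"
  have good: "good k (u k)" if "k \<ge> 2" for k using v[OF that] that by (simp add: u_def)
  have u1: "u 1 = 1" by (simp add: u_def)
  have ln_u: "ln (real (u k)) \<le> 4 * real (det_exponent k) + 2" and u_pos: "u k > 0" if "k \<ge> 2" for k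
  proof -
    show pos: "u k > 0" using good[OF that] by (auto simp: good_def)
    have "u k \<le> 4 ^ (2 * det_exponent k + 1)" using good[OF that] by (simp add: good_def)
    hence "real (u k) \<le> real (4 ^ (2 * det_exponent k + 1))" unfolding of_nat_le_iff .
    hence "ln (real (u k)) \<le> ln (real (4 ^ (2 * det_exponent k + 1)))" using pos by (intro ln_mono) auto
    also have "\<dots> = real (2 * det_exponent k + 1) * ln 4" by (simp only: of_nat_power) (subst ln_realpow; simp)
    also have "\<dots> \<le> real (2 * det_exponent k + 1) * 2" by (intro mult_left_mono ln_4_le_2) simp
    finally show "ln (real (u k)) \<le> 4 * real (det_exponent k) + 2" by simp
  qed
  have count: "real (WR_count (u k)) \<ge> (4 * real (det_exponent k) + 2) ^ k" if "k \<ge> 2" for k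
    using good[OF that] by (simp add: good_def)
  show ?thesis
  proof (rule that[of u])
    show "strict_mono_on {1..} u"
    proof (rule strict_mono_onI)
      fix k k' :: nat assume k: "k \<in> {1..}" "k' \<in> {1..}" "k < k'"
      have lo: "4 ^ (2 * det_exponent k') < u k'" using good[of k'] k by (simp add: good_def)
      show "u k < u k'"
      proof (cases "k = 1")
        case True
        have "1 \<le> (4::nat) ^ (2 * det_exponent k')" by simp
        thus ?thesis using lo unfolding True u1 by linarith
      next
        case False
        hence "k \<ge> 2" using k by simp
        hence "u k \<le> 4 ^ (2 * det_exponent k + 1)" using good by (simp add: good_def)
        also have "\<dots> \<le> 4 ^ (2 * det_exponent k')"
          using det_exponent_strict_mono[OF \<open>k \<ge> 2\<close> k(3)] by (intro power_increasing) auto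
        also note lo
        finally show ?thesis .
      qed
    qed
  next
    fix k :: nat assume k1: "k \<ge> 1"
    show "real (u k) \<in> WR_dets"
    proof (cases "k = 1")
      case True
      thus ?thesis using one_in_WR_dets by (simp add: u_def)
    next
      case False
      hence k: "k \<ge> 2" using k1 by simp
      have "(0::real) < (4 * real (det_exponent k) + 2) ^ k" by (intro zero_less_power) simp
      hence "WR_count (u k) > 0" using count[OF k] by linarith
      thus ?thesis by (rule WR_dets_of_count)
    qed
    show "real (WR_count (u k)) \<ge> ln (real (u k)) ^ k"
    proof (cases "k = 1")
      case True
      thus ?thesis by (simp add: u_def)
    next
      case False
      hence k: "k \<ge> 2" using k1 by simp
      have "ln (real (u k)) ^ k \<le> (4 * real (det_exponent k) + 2) ^ k"
        using ln_u[OF k] u_pos[OF k] by (intro power_mono) auto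
      thus ?thesis using count[OF k] by linarith
    qed
    show "real (u k) \<le> exp (9216 * (real k * ln (real k) ^ 2))"
    proof (cases "k = 1")
      case True
      thus ?thesis by (simp add: u_def)
    next
      case False
      hence k: "k \<ge> 2" using k1 by simp
      have "det_exponent k \<ge> 1" using k bit_count_ge_2[OF k] by (simp add: det_exponent_def)
      hence "ln (real (u k)) \<le> 8 * real (det_exponent k)" using ln_u[OF k] by linarith
      also have "\<dots> = 1024 * (real k * real (bit_count k) ^ 2)" by (simp add: det_exponent_def)
      also have "\<dots> \<le> 1024 * (real k * (3 * ln (real k)) ^ 2)"
        by (intro mult_left_mono power_mono bit_count_le_ln[OF k]) auto
      also have "\<dots> = 9216 * (real k * ln (real k) ^ 2)" by (simp add: power_mult_distrib)
      finally have "exp (ln (real (u k))) \<le> exp (9216 * (real k * ln (real k) ^ 2))" by simp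
      thus ?thesis using u_pos[OF k] by simp
    qed
    show "real (num_prime_divisors (u k)) \<le> 51 * (real k * ln (real k))"
    proof (cases "k = 1")
      case True
      have "{p::nat. prime p \<and> p dvd 1} = {}" by auto
      hence "num_prime_divisors 1 = 0" by (simp only: num_prime_divisors_def card.empty)
      thus ?thesis using True u1 by simp
    next
      case False
      hence k: "k \<ge> 2" using k1 by simp
      \<comment> \<open>This absorbs the additive 2, turning the factor 16 into 17.\<close>
      have "k * bit_count k \<ge> 2 * 2" by (intro mult_mono k bit_count_ge_2) auto
      hence "num_prime_divisors (u k) \<le> 17 * (k * bit_count k)"
        using good[OF k] unfolding good_def by linarith
      hence "real (num_prime_divisors (u k)) \<le> real (17 * (k * bit_count k))" unfolding of_nat_le_iff .
      also have "\<dots> = 17 * (real k * real (bit_count k))" by simp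
      also have "\<dots> \<le> 17 * (real k * (3 * ln (real k)))"
        by (intro mult_left_mono bit_count_le_ln[OF k]) auto
      finally show ?thesis by simp
    qed
  qed
qed

theorem corollary6p5:
  shows
    "(\<exists>C>0. \<forall>u>0. real (WR_count u) \<le>
        C * (real (num_divisors u) ^ 2 * 2 ^ num_prime_divisors u)) \<and>
     (\<exists>C>0. \<forall>u>0. real (num_divisors u) ^ 2 * 2 ^ num_prime_divisors u \<le>
        C * (sqrt 2 * ln (real u) / real (num_prime_divisors u)) ^ (2 * num_prime_divisors u)) \<and>
     (\<exists>C>0. \<exists>P. real ` P \<subseteq> WR_dets \<and> density_zero P \<and>
        (\<forall>u. real u \<in> WR_dets \<and> u \<notin> P \<longrightarrow>
           real (WR_count u) \<le> C * ln (real u) powr ln 8)) \<and>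
     (\<exists>u :: nat \<Rightarrow> nat. strict_mono_on {1..} u \<and>
        (\<forall>k\<ge>1. real (u k) \<in> WR_dets \<and> real (WR_count (u k)) \<ge> ln (real (u k)) ^ k)) \<and>
     (\<exists>u :: nat \<Rightarrow> nat. strict_mono_on {1..} u \<and>
        (\<forall>k\<ge>1. real (u k) \<in> WR_dets \<and> real (WR_count (u k)) \<ge> ln (real (u k)) ^ k) \<and>
        (\<exists>C>0. \<forall>k\<ge>1. real (u k) \<le> exp (C * (real k * ln (real k) ^ 2))) \<and>
        (\<exists>C>0. \<forall>k\<ge>1. real (num_prime_divisors (u k)) \<le> C * (real k * ln (real k))))"
proof (intro conjI)
  have "real (WR_count u) \<le> 32 * (real (num_divisors u) ^ 2 * 2 ^ num_prime_divisors u)" if "u > 0" for u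
  proof -
    have "WR_count u \<le> 32 * (num_divisors u ^ 2 * 2 ^ num_prime_divisors u)"
      by (rule order_trans[OF WR_count_le_card_wr_params[OF that] wr_params_bound(2)[OF that]])
    hence "real (WR_count u) \<le> real (32 * (num_divisors u ^ 2 * 2 ^ num_prime_divisors u))"
      unfolding of_nat_le_iff .
    thus ?thesis by simp
  qed
  thus "\<exists>C>0. \<forall>u>0. real (WR_count u) \<le> C * (real (num_divisors u) ^ 2 * 2 ^ num_prime_divisors u)"
    by (intro exI[of _ 32]) simp
  show "\<exists>C>0. \<forall>u>0. real (num_divisors u) ^ 2 * 2 ^ num_prime_divisors u \<le>
      C * (sqrt 2 * ln (real u) / real (num_prime_divisors u)) ^ (2 * num_prime_divisors u)"
    by (rule exI[of _ "3 ^ 16"]) (use divisor_bound_le_log in auto)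
  show "\<exists>C>0. \<exists>P. real ` P \<subseteq> WR_dets \<and> density_zero P \<and>
      (\<forall>u. real u \<in> WR_dets \<and> u \<notin> P \<longrightarrow> real (WR_count u) \<le> C * ln (real u) powr ln 8)"
    \<comment> \<open>With constant 1 the exceptional set is exactly where the bound fails, so only
      its density has to be checked.\<close>
    by (rule exI[of _ 1], simp, rule exI[of _ "{u. real u \<in> WR_dets \<and> real (WR_count u) > ln (real u) powr ln 8}"])
      (use density_zero_large_WR_count[OF ln_8_gt_2] in \<open>auto simp: not_less\<close>)
  obtain u :: "nat \<Rightarrow> nat" where u: "strict_mono_on {1..} u"
    "\<And>k. k \<ge> 1 \<Longrightarrow> real (u k) \<in> WR_dets"
    "\<And>k. k \<ge> 1 \<Longrightarrow> real (WR_count (u k)) \<ge> ln (real (u k)) ^ k"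
    "\<And>k. k \<ge> 1 \<Longrightarrow> real (u k) \<le> exp (9216 * (real k * ln (real k) ^ 2))"
    "\<And>k. k \<ge> 1 \<Longrightarrow> real (num_prime_divisors (u k)) \<le> 51 * (real k * ln (real k))"
    by (rule WR_count_log_power_sequence) blast
  show "\<exists>u :: nat \<Rightarrow> nat. strict_mono_on {1..} u \<and>
      (\<forall>k\<ge>1. real (u k) \<in> WR_dets \<and> real (WR_count (u k)) \<ge> ln (real (u k)) ^ k)"
    using u(1-3) by blast
  have "\<exists>C>0. \<forall>k\<ge>1. real (u k) \<le> exp (C * (real k * ln (real k) ^ 2))"
    by (rule exI[of _ 9216]) (use u(4) in simp)
  moreover have "\<exists>C>0. \<forall>k\<ge>1. real (num_prime_divisors (u k)) \<le> C * (real k * ln (real k))"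
    by (rule exI[of _ 51]) (use u(5) in simp)
  ultimately show "\<exists>u :: nat \<Rightarrow> nat. strict_mono_on {1..} u \<and>
      (\<forall>k\<ge>1. real (u k) \<in> WR_dets \<and> real (WR_count (u k)) \<ge> ln (real (u k)) ^ k) \<and>
      (\<exists>C>0. \<forall>k\<ge>1. real (u k) \<le> exp (C * (real k * ln (real k) ^ 2))) \<and>
      (\<exists>C>0. \<forall>k\<ge>1. real (num_prime_divisors (u k)) \<le> C * (real k * ln (real k)))"
    using u(1-3) by blast
qed

end
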